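(* There are absolute constants $c_\star>0$, $n_0<\infty$, $\kappa>0$ and $C_\star<\infty$ (one admissible explicit choice has $c_\star=10^{-5}$ and $\kappa=1/28$), and for each $n$ a proper real-algebraic subset $Z_n\subset(\mathbb R^3)^n$, such that the following holds for every $n\ge n_0$. Let the camera locations $(x_1^\star,\dots,x_n^\star)$ be generic, i.e. outside $Z_n$, let every clean triple be nondegenerate, and assume $\Delta_E\le c_\star n$. Let the triangle scores satisfy $0\le\pi_t\le1$ for all retained $t$ and $\pi_t=1$ for every clean $t$ (this includes $\pi_t\equiv1$). Put $\mu_n=\kappa n$. Let $z^{\mathrm{LS}}$ be a minimizer over $z\in\mathbb R^{T}$ of $\frac12\sum_{f\in\mathcal C}\bar w_f r_f(z)^2$, let $R_{\mathrm{LS}}=\max\{|r_f(z^{\mathrm{LS}})|: f\in\mathcal C,\ \bar w_f>0\}$, choose any $\sigma_0>0$ with $\sigma_0\ge 80R_{\mathrm{LS}}$, and set $\sigma_{k+1}=\frac12\sigma_k$ for $k\ge0$. Let $(z^{(k)})_{k\ge0}$ be any sequence in $\mathbb R^T$ such that, with $z^{(-1)}:=z^{\mathrm{LS}}$, for every $k\ge0$ the point $z^{(k)}$ is a cluster point of the orbit $z^{k,0}=z^{(k-1)}$, $z^{k,m+1}=\mathsf T_{\sigma_k}(z^{k,m})$ $(m\ge0)$ of the exact proximal Cauchy-IRLS map. Then $$\min_{\alpha\in\mathbb R}\max_{t\in T_0}|z_t^{(k)}-z_t^\star-\alpha|\longrightarrow0\qquad(k\to\infty),$$ and more quantitatively,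 for every $k\ge0$, $$\min_{\alpha\in\mathbb R}\max_{t\in T_0}|z_t^{(k)}-z_t^\star-\alpha|\le C_\star\,\Delta_E\,\frac{\sigma_k}{n}\le C_\star c_\star\sigma_k .$$
   Context: Setting. There are $n$ cameras with distinct locations $x_1^\star,\dots,x_n^\star\in\mathbb R^3$; $\ell_{ij}^\star=\|x_i^\star-x_j^\star\|$. The edges of the complete graph $K_n$ are partitioned as $E(K_n)=E_0\sqcup E_b$ (clean / corrupted), and $\Delta_E=\max_i\deg_{E_b}(i)$. Each edge carries a unit vector $d_{ij}\in\mathbb R^3$ ($d_{ji}=-d_{ij}$): for $ij\in E_0$, $d_{ij}=(x_i^\star-x_j^\star)/\ell_{ij}^\star$; for $ij\in E_b$, $d_{ij}$ is arbitrary. Triangles. For a triple $t=\{i<j<k\}$ put $a=d_{ij}$, $b=d_{jk}$, $c=d_{ki}$, and $h_{t,ij}=\|b\times c\|$, $h_{t,jk}=\|c\times a\|$, $h_{t,ki}=\|a\times b\|$. The triple is nondegenerate if these three numbers are positive. $T$ is the set of all nondegenerate triples (retained triangles). A triple is clean if its three edges lie in $E_0$; for a clean triple nondegeneracy means the three locations are not collinear. $T_0\subset T$ is the set of clean triples. For $t\in T_0$ there is a unique $s_t^\star>0$ with $s_t^\star h_{t,e}=\ell_e^\star$ for all three edges $e\subset t$; put $z_t^\star=\log s_t^\star$. Rows. $\mathcal C$ contains one row $f$, with a fixed orientation $(t,u)$, for each unordered pair of distinct retained triangles sharing a camera edge $e$; its residual is $r_f(z)=z_u-z_t-g_f$ with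 $g_f=\log(h_{t,e}/h_{u,e})$, $z\in\mathbb R^T$. Its base weight is $\bar w_f=\sqrt{\pi_t\pi_u}$. Exact proximal Cauchy-IRLS map at scale $\sigma>0$: with $\omega_\sigma(r)=\frac{1}{1+(r/\sigma)^2}$, $$\mathsf T_\sigma(x)=\arg\min_{z\in\mathbb R^T}\Big\{\tfrac12\sum_{f\in\mathcal C}\bar w_f\,\omega_\sigma(r_f(x))\,r_f(z)^2+\tfrac{\mu_n}{2}\|z-x\|_2^2\Big\},$$ which is the unique minimizer of a strictly convex quadratic. *)

theory Defs
  imports "HOL-Analysis.Analysis"
begin

text \<open>The cameras are indexed by \<open>{..<n}\<close>, and a point of the configuration space
  $(\mathbb R^3)^n$ is an extensional function on \<open>{..<n}\<close>. Edges of $K_n$ are two-element sets.\<close>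

definition configs :: "nat \<Rightarrow> (nat \<Rightarrow> real^3) set" where
  "configs n = {..<n} \<rightarrow>\<^sub>E UNIV"

text \<open>Polynomial functions in the \<open>3 * n\<close> coordinates; the analogue of
  \<^const>\<open>real_polynomial_function\<close> on a space whose dimension is not fixed by a type.\<close>

inductive config_polynomial :: "nat \<Rightarrow> ((nat \<Rightarrow> real^3) \<Rightarrow> real) \<Rightarrow> bool" for n where
  coord: "i < n \<Longrightarrow> config_polynomial n (\<lambda>x. x i $ m)"
| const: "config_polynomial n (\<lambda>x. c)"
| add: "config_polynomial n p \<Longrightarrow> config_polynomial n q \<Longrightarrow> config_polynomial n (\<lambda>x. p x + q x)"
| mult: "config_polynomial n p \<Longrightarrow> config_polynomial n q \<Longrightarrow> config_polynomial n (\<lambda>x. p x * q x)"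

definition real_algebraic_subset :: "nat \<Rightarrow> (nat \<Rightarrow> real^3) set \<Rightarrow> bool" where
  "real_algebraic_subset n Z \<longleftrightarrow>
     (\<exists>P. finite P \<and> (\<forall>p\<in>P. config_polynomial n p) \<and> Z = {x \<in> configs n. \<forall>p\<in>P. p x = 0})"

definition edges :: "nat \<Rightarrow> nat set set" where
  "edges n = {{i, j} | i j. i < j \<and> j < n}"

definition max_degree :: "nat \<Rightarrow> nat set set \<Rightarrow> nat" where
  "max_degree n E = (MAX i\<in>{..<n}. card {e \<in> E. i \<in> e})"

definition camera_setting ::
  "nat \<Rightarrow> (nat \<Rightarrow> real^3) \<Rightarrow> nat set set \<Rightarrow> nat set set \<Rightarrow> (nat \<Rightarrow> nat \<Rightarrow> real^3) \<Rightarrow> bool" where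
  "camera_setting n x E0 Eb d \<longleftrightarrow>
     x \<in> configs n \<and> inj_on x {..<n} \<and>
     E0 \<union> Eb = edges n \<and> E0 \<inter> Eb = {} \<and>
     (\<forall>i<n. \<forall>j<n. i \<noteq> j \<longrightarrow> norm (d i j) = 1 \<and> d j i = - d i j) \<and>
     (\<forall>i<n. \<forall>j<n. {i, j} \<in> E0 \<longrightarrow> d i j = (x i - x j) /\<^sub>R norm (x i - x j))"

type_synonym triple = "nat \<times> nat \<times> nat"

definition triples :: "nat \<Rightarrow> triple set" where
  "triples n = {(i, j, k). i < j \<and> j < k \<and> k < n}"

fun tri_edges :: "triple \<Rightarrow> nat set set" where
  "tri_edges (i, j, k) = {{i, j}, {j, k}, {k, i}}"

fun tri_h :: "(nat \<Rightarrow> nat \<Rightarrow> real^3) \<Rightarrow> triple \<Rightarrow> nat set \<Rightarrow> real" where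
  "tri_h d (i, j, k) e =
     (let a = d i j; b = d j k; c = d k i in
      if e = {i, j} then norm (cross3 b c)
      else if e = {j, k} then norm (cross3 c a)
      else if e = {k, i} then norm (cross3 a b)
      else 0)"

definition nondegenerate :: "(nat \<Rightarrow> nat \<Rightarrow> real^3) \<Rightarrow> triple \<Rightarrow> bool" where
  "nondegenerate d t \<longleftrightarrow> (\<forall>e\<in>tri_edges t. tri_h d t e > 0)"

definition retained :: "nat \<Rightarrow> (nat \<Rightarrow> nat \<Rightarrow> real^3) \<Rightarrow> triple set" where
  "retained n d = {t \<in> triples n. nondegenerate d t}"

definition clean_triples :: "nat \<Rightarrow> nat set set \<Rightarrow> triple set" where
  "clean_triples n E0 = {t \<in> triples n. tri_edges t \<subseteq> E0}"

definition clean_retained :: "nat \<Rightarrow> nat set set \<Rightarrow> (nat \<Rightarrow> nat \<Rightarrow> real^3) \<Rightarrow> triple set" where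
  "clean_retained n E0 d = retained n d \<inter> clean_triples n E0"

definition s_star :: "(nat \<Rightarrow> real^3) \<Rightarrow> (nat \<Rightarrow> nat \<Rightarrow> real^3) \<Rightarrow> triple \<Rightarrow> real" where
  "s_star x d t =
     (THE s. s > 0 \<and> (\<forall>i j. {i, j} \<in> tri_edges t \<longrightarrow> s * tri_h d t {i, j} = norm (x i - x j)))"

definition z_star :: "(nat \<Rightarrow> real^3) \<Rightarrow> (nat \<Rightarrow> nat \<Rightarrow> real^3) \<Rightarrow> triple \<Rightarrow> real" where
  "z_star x d t = ln (s_star x d t)"

definition adjacent_triangles :: "nat \<Rightarrow> (nat \<Rightarrow> nat \<Rightarrow> real^3) \<Rightarrow> (triple \<times> triple) set" where
  "adjacent_triangles n d =
     {(t, u). t \<in> retained n d \<and> u \<in> retained n d \<and> t \<noteq> u \<and> tri_edges t \<inter> tri_edges u \<noteq> {}}"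

text \<open>A row system contains exactly one of the two orientations of every adjacent pair;
  which one is left arbitrary.\<close>

definition row_system ::
  "nat \<Rightarrow> (nat \<Rightarrow> nat \<Rightarrow> real^3) \<Rightarrow> (triple \<times> triple) set \<Rightarrow> bool" where
  "row_system n d R \<longleftrightarrow>
     R \<subseteq> adjacent_triangles n d \<and>
     (\<forall>(t, u)\<in>adjacent_triangles n d. (t, u) \<in> R \<longleftrightarrow> (u, t) \<notin> R)"

text \<open>Two distinct triples have at most one edge in common, so \<^const>\<open>the_elem\<close> is applied to a
  singleton.\<close>

fun row_g :: "(nat \<Rightarrow> nat \<Rightarrow> real^3) \<Rightarrow> triple \<times> triple \<Rightarrow> real" where
  "row_g d (t, u) =
     (let e = the_elem (tri_edges t \<inter> tri_edges u) in ln (tri_h d t e / tri_h d u e))"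

fun residual ::
  "(nat \<Rightarrow> nat \<Rightarrow> real^3) \<Rightarrow> triple \<times> triple \<Rightarrow> (triple \<Rightarrow> real) \<Rightarrow> real" where
  "residual d (t, u) z = z u - z t - row_g d (t, u)"

fun base_weight :: "(triple \<Rightarrow> real) \<Rightarrow> triple \<times> triple \<Rightarrow> real" where
  "base_weight score (t, u) = sqrt (score t * score u)"

text \<open>$\mathbb R^T$ as extensional functions, with the topology induced by the product topology
  on \<open>triple \<Rightarrow> real\<close>.\<close>

definition log_scales :: "nat \<Rightarrow> (nat \<Rightarrow> nat \<Rightarrow> real^3) \<Rightarrow> (triple \<Rightarrow> real) set" where
  "log_scales n d = retained n d \<rightarrow>\<^sub>E UNIV"

definition ls_objective ::
  "(nat \<Rightarrow> nat \<Rightarrow> real^3) \<Rightarrow> (triple \<times> triple) set \<Rightarrow> (triple \<Rightarrow> real) \<Rightarrow> (triple \<Rightarrow> real) \<Rightarrow> real" where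
  "ls_objective d R score z = 1/2 * (\<Sum>f\<in>R. base_weight score f * (residual d f z)\<^sup>2)"

definition max_ls_residual ::
  "(nat \<Rightarrow> nat \<Rightarrow> real^3) \<Rightarrow> (triple \<times> triple) set \<Rightarrow> (triple \<Rightarrow> real) \<Rightarrow> (triple \<Rightarrow> real) \<Rightarrow> real" where
  "max_ls_residual d R score z = Max {\<bar>residual d f z\<bar> | f. f \<in> R \<and> base_weight score f > 0}"

definition cauchy_weight :: "real \<Rightarrow> real \<Rightarrow> real" where
  "cauchy_weight \<sigma> r = 1 / (1 + (r / \<sigma>)\<^sup>2)"

definition prox_objective ::
  "nat \<Rightarrow> (nat \<Rightarrow> nat \<Rightarrow> real^3) \<Rightarrow> (triple \<times> triple) set \<Rightarrow> (triple \<Rightarrow> real) \<Rightarrow> real \<Rightarrow> real \<Rightarrow>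
   (triple \<Rightarrow> real) \<Rightarrow> (triple \<Rightarrow> real) \<Rightarrow> real" where
  "prox_objective n d R score \<mu> \<sigma> x z =
     1/2 * (\<Sum>f\<in>R. base_weight score f * cauchy_weight \<sigma> (residual d f x) * (residual d f z)\<^sup>2)
     + \<mu> / 2 * (\<Sum>t\<in>retained n d. (z t - x t)\<^sup>2)"

definition prox_irls_map ::
  "nat \<Rightarrow> (nat \<Rightarrow> nat \<Rightarrow> real^3) \<Rightarrow> (triple \<times> triple) set \<Rightarrow> (triple \<Rightarrow> real) \<Rightarrow> real \<Rightarrow> real \<Rightarrow>
   (triple \<Rightarrow> real) \<Rightarrow> (triple \<Rightarrow> real)" where
  "prox_irls_map n d R score \<mu> \<sigma> x =
     arg_min_on (prox_objective n d R score \<mu> \<sigma> x) (log_scales n d)"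

definition cluster_point :: "(nat \<Rightarrow> 'a::topological_space) \<Rightarrow> 'a \<Rightarrow> bool" where
  "cluster_point X l \<longleftrightarrow> (\<forall>U. open U \<and> l \<in> U \<longrightarrow> (\<exists>\<^sub>F m in sequentially. X m \<in> U))"

text \<open>The infimum over the gauge \<open>\<alpha>\<close> is attained, because the maximum over a nonempty finite set
  is continuous and coercive in \<open>\<alpha>\<close>.\<close>

definition gauge_error ::
  "nat \<Rightarrow> (nat \<Rightarrow> real^3) \<Rightarrow> nat set set \<Rightarrow> (nat \<Rightarrow> nat \<Rightarrow> real^3) \<Rightarrow> (triple \<Rightarrow> real) \<Rightarrow> real" where
  "gauge_error n x E0 d z =
     (INF \<alpha>. MAX t\<in>clean_retained n E0 d. \<bar>z t - z_star x d t - \<alpha>\<bar>)"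

end

theory Submission
  imports Defs
begin

text \<open>Measure \<open>z\<close> by its deviation \<open>err z\<close> from the true log-scales. By the law of sines a row between clean
  triangles has residual \<open>err z u - err z t\<close>, so on clean triangles a prox step is a damped averaging step
  on (almost) the Johnson graph \<open>J(n, 3)\<close>, forced by the at most \<open>6 \<Delta>\<close> corrupted neighbours of each triangle.
  The Cauchy influence is at most \<open>\<sigma> / 2\<close> and, by the maximum principle, no coordinate moves by more than
  \<open>42 \<sigma>\<close>; so the forcing is at most \<open>6 \<Delta> (\<sigma> / 2 + 84 \<sigma>) = 507 \<Delta> \<sigma>\<close>. Averaging three times joins almost all
  pairs of triangles by \<open>36\<close> paths, which turns this into a bound \<open>O(\<Delta> \<sigma> / n)\<close> on the oscillation of \<open>err\<close>.
  Hence "clean oscillation at most \<open>\<sigma> / 10\<close>" is invariant under the iteration. Majorization of the Cauchy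
  loss makes cluster points stationary, where the forcing is only \<open>3 \<Delta> \<sigma>\<close>, and the resulting oscillation is small
  enough to restart with \<open>\<sigma> / 2\<close>.\<close>

section \<open>Triangles and their shared edges\<close>

text \<open>Two obstacles shape the argument. Nothing is known about the log-scales of corrupted
  triangles, so their rows enter only through bounds that hold for every residual. And the weights
  are frozen at the old iterate while the residuals are taken at the new one, so the bound
  \<open>\<sigma> / 2\<close> does not apply directly: a step length has to be added.

  This explains \<open>\<kappa> = 1/28\<close>. The step bound is
  \<open>3 * \<sigma> / (2 * \<kappa>)\<close>, so \<kappa> must not be too small; but the damping
  enters the averaging factor as \<open>1.01 * (3 + \<kappa>)\<close>, which has to stay below 3.1.
  Invariance of the threshold \<open>\<sigma> / 10\<close> then needs
  \<open>13.1 * 507 * \<Delta> <= n / 10\<close>, that is \<open>66417 * \<Delta> <= n\<close>; with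
  \<open>\<Delta> <= n / 10^5\<close> the slack is only a factor of about 1.5.

  The threshold \<open>\<sigma> / 10\<close> itself keeps every weight between clean triangles in
  the interval from 100/101 to 1, so clean rows act almost like an unweighted graph.\<close>

fun verts :: "triple \<Rightarrow> nat set" where
  "verts (i, j, k) = {i, j, k}"

text \<open>Built from the unordered vertex set, so invariance under permutations is immediate. The
  existential over \<open>n\<close> frees the term from the size parameter.\<close>

definition tri :: "nat \<Rightarrow> nat \<Rightarrow> nat \<Rightarrow> triple" where
  "tri a b c = (THE t. (\<exists>n. t \<in> triples n) \<and> verts t = {a, b, c})"

lemma triples_verts_inj:
  assumes "t \<in> triples n" "u \<in> triples m" "verts t = verts u"
  shows "t = u"
proof -
  obtain i j k where t: "t = (i, j, k)" "i < j" "j < k"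
    using assms(1) by (auto simp: triples_def)
  obtain i' j' k' where u: "u = (i', j', k')" "i' < j'" "j' < k'"
    using assms(2) by (auto simp: triples_def)
  have eq: "{i, j, k} = {i', j', k'}" using assms(3) t(1) u(1) by simp
  have m: "Min {i, j, k} = i" "Min {i', j', k'} = i'" "Max {i, j, k} = k" "Max {i', j', k'} = k'"
    using t u by simp_all
  have "i = i'" "k = k'" using m eq by metis+
  moreover have "j = j'"
    using eq t u \<open>i = i'\<close> \<open>k = k'\<close> by (metis insertE insertI1 insert_commute less_irrefl singletonD)
  ultimately show ?thesis using t u by simp
qed

lemma ex_triple:
  assumes "a < n" "b < n" "c < n" "a \<noteq> b" "b \<noteq> c" "c \<noteq> (a::nat)"
  shows "\<exists>t\<in>triples n. verts t = {a, b, c}"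
proof -
  have S: "\<exists>t\<in>triples n. verts t = {p, q, r}" if "p < q" "q < r" "r < n" for p q r
    using that by (intro bexI[of _ "(p, q, r)"]) (auto simp: triples_def)
  have "a < b \<and> b < c \<or> a < c \<and> c < b \<or> b < a \<and> a < c \<or> b < c \<and> c < a \<or> c < a \<and> a < b \<or> c < b \<and> b < a"
    using assms by linarith
  then show ?thesis
    using S[of a b c] S[of a c b] S[of b a c] S[of b c a] S[of c a b] S[of c b a] assms(1-3)
    by (auto simp: insert_commute)
qed

lemma tri_eqI: "t \<in> triples n \<Longrightarrow> verts t = {a, b, c} \<Longrightarrow> tri a b c = t"
  unfolding tri_def by (rule the_equality) (blast, metis triples_verts_inj)

lemma tri_props:
  assumes "a < n" "b < n" "c < n" "a \<noteq> b" "b \<noteq> c" "c \<noteq> (a::nat)"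
  shows "tri a b c \<in> triples n" "verts (tri a b c) = {a, b, c}"
  using ex_triple[OF assms] tri_eqI by auto

lemma tri_commute: "tri a b c = tri b a c" "tri a b c = tri a c b"
  by (simp_all add: tri_def insert_commute)

lemma tri_edges_iff:
  assumes "t \<in> triples n"
  shows "e \<in> tri_edges t \<longleftrightarrow> (\<exists>a b. e = {a, b} \<and> a \<noteq> b \<and> a \<in> verts t \<and> b \<in> verts t)"
proof -
  obtain i j k where t: "t = (i, j, k)" "i < j" "j < k"
    using assms by (auto simp: triples_def)
  show ?thesis
  proof
    assume "e \<in> tri_edges t"
    then have "e = {i, j} \<or> e = {j, k} \<or> e = {k, i}" using t by simp
    moreover have "i \<noteq> j" "j \<noteq> k" "k \<noteq> i" using t by auto
    moreover have "i \<in> verts t" "j \<in> verts t" "k \<in> verts t" using t by auto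
    ultimately show "\<exists>a b. e = {a, b} \<and> a \<noteq> b \<and> a \<in> verts t \<and> b \<in> verts t" by blast
  qed (use t in \<open>auto simp: insert_commute\<close>)
qed

lemma tri_edges_pair_iff:
  assumes "t \<in> triples n"
  shows "{a, b} \<in> tri_edges t \<longleftrightarrow> a \<noteq> b \<and> a \<in> verts t \<and> b \<in> verts t"
  using assms by (cases t) (auto simp: triples_def doubleton_eq_iff)

lemma card_verts: "t \<in> triples n \<Longrightarrow> card (verts t) = 3"
  by (cases t) (auto simp: triples_def)

lemma finite_triples [simp]: "finite (triples n)"
  by (rule finite_subset[of _ "{..<n} \<times> {..<n} \<times> {..<n}"]) (auto simp: triples_def)

lemma verts_less: "t \<in> triples n \<Longrightarrow> v \<in> verts t \<Longrightarrow> v < n"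
  by (cases t) (auto simp: triples_def)

lemma finite_verts [simp]: "finite (verts t)"
  by (cases t) simp

text \<open>Neighbours are the triangles obtained by exchanging one vertex. The new vertex lies
  outside \<open>t\<close>, since otherwise \<open>u\<close> and \<open>t\<close> would have the
  same three vertices.\<close>

lemma shared_edge_third_vertex:
  assumes t: "t \<in> triples n" and u: "u \<in> triples n" "t \<noteq> u"
    and e: "{a, b} \<in> tri_edges t \<inter> tri_edges u"
  shows "\<exists>l. l < n \<and> l \<notin> verts t \<and> u = tri a b l \<and> verts u = {a, b, l}"
proof -
  have ab: "a \<noteq> b" "a \<in> verts t" "b \<in> verts t" "a \<in> verts u" "b \<in> verts u"
    using e tri_edges_pair_iff[OF t, of a b] tri_edges_pair_iff[OF u(1), of a b] by simp_all
  have "card (verts u - {a, b}) = card (verts u) - card {a, b}"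
    by (rule card_Diff_subset) (use ab in simp_all)
  then have "card (verts u - {a, b}) = 1"
    using ab(1) card_verts[OF u(1)] by simp
  then obtain l where l0: "verts u - {a, b} = {l}" by (rule card_1_singletonE)
  then have l: "verts u = {a, b, l}" using ab(4,5) by blast
  have "l \<notin> verts t"
  proof
    assume "l \<in> verts t"
    then have "verts u \<subseteq> verts t" unfolding l using ab(2,3) by simp
    moreover have "card (verts u) = card (verts t)"
      using card_verts[OF t] card_verts[OF u(1)] by simp
    ultimately have "verts u = verts t" by (rule card_subset_eq[OF finite_verts])
    from triples_verts_inj[OF t u(1) this[symmetric]] u(2) show False by simp
  qed
  moreover have "l < n" using verts_less[OF u(1)] l by simp
  moreover have "u = tri a b l" using tri_eqI[OF u(1) l] by simp
  ultimately show ?thesis using l by blast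
qed

text \<open>Makes \<open>the_elem\<close> in \<open>row_g\<close> meaningful: the vertex of
  \<open>u\<close> opposite a shared edge is not in \<open>t\<close>, so it lies on no other shared
  edge.\<close>

lemma shared_edge_unique:
  assumes t: "t \<in> triples n" and u: "u \<in> triples n" "t \<noteq> u"
    and e: "e \<in> tri_edges t \<inter> tri_edges u"
  shows "tri_edges t \<inter> tri_edges u = {e}"
proof -
  obtain a b where ab: "e = {a, b}" using e tri_edges_iff[OF t, of e] by blast
  obtain l where l: "l \<notin> verts t" "verts u = {a, b, l}"
    using shared_edge_third_vertex[OF t u, of a b] e ab by blast
  have "e' = e" if e': "e' \<in> tri_edges t \<inter> tri_edges u" for e'
  proof -
    obtain p q where pq: "e' = {p, q}" "p \<noteq> q" "p \<in> verts t" "q \<in> verts t"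
      using e' tri_edges_iff[OF t, of e'] by blast
    have "p \<in> verts u" "q \<in> verts u"
      using e' pq(1) tri_edges_pair_iff[OF u(1), of p q] by simp_all
    then have "p \<in> {a, b}" "q \<in> {a, b}" using pq l by auto
    then show ?thesis unfolding ab pq(1) using pq(2) by auto
  qed
  then show ?thesis using e by blast
qed

text \<open>Replacing the three vertices one after the other, in all \<open>3!\<close> orders, gives the factor \<open>6\<close>; keeping all
  orders is what makes the final constants fit.\<close>
lemma ordered_triple_sum_bound:
  fixes P :: "nat \<Rightarrow> nat \<Rightarrow> nat \<Rightarrow> real" and E :: "nat set set"
  assumes nonneg: "\<And>a b c. 0 \<le> P a b c"
    and sym: "\<And>a b c. P a b c = P b a c" "\<And>a b c. P a b c = P a c b"
    and zero: "\<And>a b c. \<not> ({a, b} \<in> E \<and> {b, c} \<in> E \<and> {c, a} \<in> E) \<Longrightarrow> P a b c = 0"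
    and loop: "\<And>a. {a, a} \<notin> E"
    and local: "\<And>i j k L. {i, j} \<in> E \<Longrightarrow> {j, k} \<in> E \<Longrightarrow> {k, i} \<in> E \<Longrightarrow> finite L \<Longrightarrow> L \<inter> {i, j, k} = {} \<Longrightarrow>
        (\<Sum>l\<in>L. P l j k + P i l k + P i j l) \<le> \<beta> * P i j k + B"
    and ijk: "{i, j} \<in> E" "{j, k} \<in> E" "{k, i} \<in> E"
    and F: "finite F" "real (card F) \<le> m" "\<And>l. l \<in> F \<Longrightarrow> {l, i} \<in> E \<and> {l, j} \<in> E \<and> {l, k} \<in> E"
    and \<beta>: "0 \<le> \<beta>" and B: "0 \<le> B"
  shows "6 * (\<Sum>a\<in>F. \<Sum>b\<in>F. \<Sum>c\<in>F. P a b c)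
           \<le> \<beta>^3 * P i j k + B * (\<beta>\<^sup>2 + 3 * m * \<beta> + 6 * m\<^sup>2)"
proof -
  define U where "U v = (\<Sum>a\<in>F. \<Sum>b\<in>F. P a b v)" for v
  define V where "V u v = (\<Sum>a\<in>F. P a u v)" for u v
  have flip: "{a, b} = {b, a}" for a b :: nat by auto
  have diag: "P a a c = 0" "P a c a = 0" "P c a a = 0" for a c
    using zero[of a a c] zero[of a c a] zero[of c a a] loop by auto
  \<comment> \<open>Last replacement: the local bound at the triangle \<open>a b v\<close> with an
    old vertex \<open>v\<close>, keeping only the exchange of \<open>v\<close>. Indices
    \<open>c\<close> in \<open>{a, b}\<close> may be dropped because there are no loops.\<close>
  have step3: "(\<Sum>c\<in>F. P a b c) \<le> \<beta> * P a b v + B" if "a \<in> F" "b \<in> F" "v \<in> {i, j, k}" for a b v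
  proof (cases "{a, b} \<in> E")
    case True
    have "{b, v} \<in> E" "{v, a} \<in> E" using that F(3) flip by auto
    have "v \<notin> F" using F(3)[of v] that(3) loop by auto
    have "(\<Sum>c\<in>F. P a b c) = (\<Sum>c\<in>F - {a, b}. P a b c)"
      by (rule sum.mono_neutral_right) (use F(1) diag in auto)
    also have "\<dots> \<le> (\<Sum>l\<in>F - {a, b}. P l b v + P a l v + P a b l)"
      by (rule sum_mono) (use nonneg in \<open>simp add: add_nonneg_nonneg\<close>)
    also have "\<dots> \<le> \<beta> * P a b v + B"
      by (rule local) (use True \<open>{b, v} \<in> E\<close> \<open>{v, a} \<in> E\<close> F(1) \<open>v \<notin> F\<close> in auto)
    finally show ?thesis .
  next
    case False
    then have "(\<Sum>c\<in>F. P a b c) = 0" using zero by (auto intro: sum.neutral)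
    then show ?thesis using nonneg \<beta> B by simp
  qed
  have S3: "(\<Sum>a\<in>F. \<Sum>b\<in>F. \<Sum>c\<in>F. P a b c) \<le> \<beta> * U v + m\<^sup>2 * B" if "v \<in> {i, j, k}" for v
  proof -
    have "(\<Sum>a\<in>F. \<Sum>b\<in>F. \<Sum>c\<in>F. P a b c) \<le> (\<Sum>a\<in>F. \<Sum>b\<in>F. \<beta> * P a b v + B)"
      by (intro sum_mono step3 that)
    also have "\<dots> = \<beta> * U v + (real (card F))\<^sup>2 * B"
      by (simp add: U_def sum.distrib sum_distrib_left power2_eq_square)
    also have "\<dots> \<le> \<beta> * U v + m\<^sup>2 * B"
      using F(2) B by (intro add_left_mono mult_right_mono power_mono) auto
    finally show ?thesis .
  qed
  \<comment> \<open>Two old vertices remain here, so two of the three exchanges in the local bound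
    are kept and give two terms on the left.\<close>
  have S2: "U u + U v \<le> \<beta> * V u v + m * B" if uv: "{u, v} \<in> E" "u \<in> {i, j, k}" "v \<in> {i, j, k}" for u v
  proof -
    have "(\<Sum>b\<in>F. P a b u + P a b v) \<le> \<beta> * P a u v + B" if "a \<in> F" for a
    proof -
      have e: "{a, u} \<in> E" "{v, a} \<in> E" using that uv F(3) flip by auto
      have nF: "u \<notin> F" "v \<notin> F" using F(3)[of u] F(3)[of v] uv loop by auto
      have "(\<Sum>b\<in>F. P a b u + P a b v) = (\<Sum>b\<in>F - {a}. P a b u + P a b v)"
        by (rule sum.mono_neutral_right) (use F(1) diag in auto)
      also have "\<dots> \<le> (\<Sum>l\<in>F - {a}. P l u v + P a l v + P a u l)"
        by (rule sum_mono) (use nonneg sym(2)[of a u] in simp)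
      also have "\<dots> \<le> \<beta> * P a u v + B"
        by (rule local) (use e uv F(1) nF in auto)
      finally show ?thesis .
    qed
    then have "(\<Sum>a\<in>F. \<Sum>b\<in>F. P a b u + P a b v) \<le> (\<Sum>a\<in>F. \<beta> * P a u v + B)"
      by (rule sum_mono)
    also have "\<dots> = \<beta> * V u v + real (card F) * B"
      by (simp add: V_def sum.distrib sum_distrib_left)
    also have "\<dots> \<le> \<beta> * V u v + m * B"
      using F(2) B by (intro add_left_mono mult_right_mono) auto
    finally show ?thesis by (simp add: U_def sum.distrib)
  qed
  \<comment> \<open>All three vertices are old, and all three exchanges are kept.\<close>
  have S1: "V j k + V i k + V i j \<le> \<beta> * P i j k + B"
  proof -
    have s: "P i l k = P l i k" "P i j l = P l i j" for l
      using sym(1)[of i l k] sym(2)[of i j l] sym(1)[of i l j] by simp_all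
    have nF: "i \<notin> F" "j \<notin> F" "k \<notin> F" using F(3)[of i] F(3)[of j] F(3)[of k] loop by auto
    have "V j k + V i k + V i j = (\<Sum>l\<in>F. P l j k + P i l k + P i j l)"
      unfolding V_def sum.distrib by (simp only: s)
    also have "\<dots> \<le> \<beta> * P i j k + B"
      by (rule local) (use ijk F(1) nF in auto)
    finally show ?thesis .
  qed
  let ?S = "\<Sum>a\<in>F. \<Sum>b\<in>F. \<Sum>c\<in>F. P a b c"
  \<comment> \<open>Averaging over the choice of old vertex: three choices at the last level, two at
    the middle one, one at the first, whence the factor 6.\<close>
  have "3 * ?S \<le> \<beta> * (U i + U j + U k) + 3 * m\<^sup>2 * B"
    using S3[of i] S3[of j] S3[of k] by (simp add: distrib_left)
  moreover have "2 * (U i + U j + U k) \<le> \<beta> * (V j k + V i k + V i j) + 3 * m * B"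
    using S2[of j k] S2[of i k] S2[of i j] ijk flip by (simp add: distrib_left)
  moreover have "\<beta> * (V j k + V i k + V i j) \<le> \<beta> * (\<beta> * P i j k + B)"
    using S1 \<beta> by (rule mult_left_mono)
  ultimately have U: "2 * (U i + U j + U k) \<le> \<beta> * (\<beta> * P i j k + B) + 3 * m * B"
    and S: "6 * ?S \<le> \<beta> * (2 * (U i + U j + U k)) + 6 * m\<^sup>2 * B"
    by linarith+
  have "\<beta> * (2 * (U i + U j + U k)) \<le> \<beta> * (\<beta> * (\<beta> * P i j k + B) + 3 * m * B)"
    using U \<beta> by (rule mult_left_mono)
  with S have "6 * ?S \<le> \<beta> * (\<beta> * (\<beta> * P i j k + B) + 3 * m * B) + 6 * m\<^sup>2 * B" by linarith
  then show ?thesis by (simp add: algebra_simps power2_eq_square power3_eq_cube)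
qed

section \<open>Geometry and counting for a camera configuration\<close>

text \<open>For the side vectors of a closed triangle the three cross products are one and the same
  normal vector, whose length is twice the area.\<close>

lemma cross3_closed_triangle:
  assumes "p + q + r = (0 :: real^3)"
  shows "cross3 r p = cross3 q r" "cross3 p q = cross3 q r"
proof -
  have p: "p = - q - r" using assms by (simp add: eq_neg_iff_add_eq_0 algebra_simps)
  show "cross3 r p = cross3 q r" "cross3 p q = cross3 q r"
    unfolding p cross3_def by (simp_all add: vec_eq_iff forall_3 algebra_simps)
qed

locale camera_rows =
  fixes n :: nat and loc :: "nat \<Rightarrow> real^3" and E0 Eb :: "nat set set"
    and d :: "nat \<Rightarrow> nat \<Rightarrow> real^3" and score :: "triple \<Rightarrow> real" and R :: "(triple \<times> triple) set"
  assumes setting: "camera_setting n loc E0 Eb d"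
    and clean_nondegenerate: "\<And>t. t \<in> clean_triples n E0 \<Longrightarrow> nondegenerate d t"
    and rows: "row_system n d R"
    and score_nonneg: "\<And>t. t \<in> retained n d \<Longrightarrow> 0 \<le> score t"
    and score_le_1: "\<And>t. t \<in> retained n d \<Longrightarrow> score t \<le> 1"
    and score_clean: "\<And>t. t \<in> clean_retained n E0 d \<Longrightarrow> score t = 1"
begin

abbreviation "T \<equiv> retained n d"
abbreviation "V \<equiv> clean_retained n E0 d"
abbreviation "\<Delta> \<equiv> real (max_degree n Eb)"

definition nbrs :: "triple \<Rightarrow> triple set" where
  "nbrs t = {u. (t, u) \<in> adjacent_triangles n d}"

definition wt :: "triple \<Rightarrow> triple \<Rightarrow> real" where
  "wt t u = base_weight score (t, u)"

definition res :: "triple \<Rightarrow> triple \<Rightarrow> (triple \<Rightarrow> real) \<Rightarrow> real" where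
  "res t u z = residual d (t, u) z"

definition err :: "(triple \<Rightarrow> real) \<Rightarrow> triple \<Rightarrow> real" where
  "err z t = z t - z_star loc d t"

lemma E0_edges: "E0 \<subseteq> edges n" and Eb_edges: "Eb \<subseteq> edges n"
  and edges_split: "E0 \<union> Eb = edges n"
  using setting by (auto simp: camera_setting_def)

lemma pair_in_edges: "{a, b} \<in> edges n \<longleftrightarrow> a < n \<and> b < n \<and> a \<noteq> b"
proof
  assume "a < n \<and> b < n \<and> a \<noteq> b"
  then show "{a, b} \<in> edges n" unfolding edges_def
    by (cases a b rule: linorder_cases) (auto simp: doubleton_eq_iff)
qed (auto simp: edges_def doubleton_eq_iff)

lemma E0_pair: "{a, b} \<in> E0 \<Longrightarrow> a < n \<and> b < n \<and> a \<noteq> b"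
  using E0_edges pair_in_edges by blast

lemma E0_loop: "{a, a} \<notin> E0"
  using E0_pair by blast

lemma finite_Eb: "finite Eb"
proof (rule finite_subset[OF Eb_edges])
  show "finite (edges n)"
    by (rule finite_subset[of _ "(\<lambda>(i, j). {i, j}) ` ({..<n} \<times> {..<n})"]) (auto simp: edges_def)
qed

lemma T_triples: "t \<in> T \<Longrightarrow> t \<in> triples n"
  by (simp add: retained_def)

lemma finite_T [simp]: "finite T"
  by (rule finite_subset[of _ "triples n"]) (auto simp: retained_def)

lemma V_subset_T: "V \<subseteq> T"
  by (auto simp: clean_retained_def)

lemma finite_V [simp]: "finite V"
  by (rule finite_subset[OF V_subset_T finite_T])

lemma V_iff: "t \<in> V \<longleftrightarrow> t \<in> triples n \<and> tri_edges t \<subseteq> E0"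
  using clean_nondegenerate[of t] by (auto simp: clean_retained_def clean_triples_def retained_def)

lemma V_triples: "t \<in> V \<Longrightarrow> t \<in> triples n" and V_edges: "t \<in> V \<Longrightarrow> tri_edges t \<subseteq> E0"
  by (simp_all add: V_iff)

lemma V_pair: "t \<in> V \<Longrightarrow> a \<in> verts t \<Longrightarrow> b \<in> verts t \<Longrightarrow> a \<noteq> b \<Longrightarrow> {a, b} \<in> E0"
  using V_iff tri_edges_pair_iff by blast

lemma tri_in_V:
  assumes "{a, b} \<in> E0" "{b, c} \<in> E0" "{c, a} \<in> E0"
  shows "tri a b c \<in> V" "verts (tri a b c) = {a, b, c}"
proof -
  have *: "a < n" "b < n" "c < n" "a \<noteq> b" "b \<noteq> c" "c \<noteq> a"
    using assms E0_pair by blast+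
  note t = tri_props[OF *]
  show "verts (tri a b c) = {a, b, c}" by (rule t)
  have "e \<in> E0" if e: "e \<in> tri_edges (tri a b c)" for e
  proof -
    obtain p q where "e = {p, q}" "p \<noteq> q" "p \<in> {a, b, c}" "q \<in> {a, b, c}"
      using e tri_edges_iff[OF t(1), of e] t(2) by auto
    then show ?thesis using assms by (auto simp: insert_commute)
  qed
  then show "tri a b c \<in> V" using V_iff t(1) by blast
qed

lemma tri_h_pos: "t \<in> T \<Longrightarrow> e \<in> tri_edges t \<Longrightarrow> 0 < tri_h d t e"
  by (simp add: retained_def nondegenerate_def)

text \<open>With \<open>A\<close> twice the area, the height number of a side is \<open>A\<close>
  divided by the product of the other two lengths. Hence the product of all three lengths over
  \<open>A\<close> serves all sides at once; it is the diameter of the circumscribed circle.\<close>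

lemma law_of_sines:
  assumes "t \<in> V"
  shows "\<exists>s>0. \<forall>a b. {a, b} \<in> tri_edges t \<longrightarrow> s * tri_h d t {a, b} = norm (loc a - loc b)"
proof -
  obtain i j k where t: "t = (i, j, k)" and ijk: "i < j" "j < k" "k < n"
    using V_triples[OF assms] by (auto simp: triples_def)
  have E: "{i, j} \<in> E0" "{j, k} \<in> E0" "{k, i} \<in> E0" using V_edges[OF assms] by (auto simp: t)
  have inj: "inj_on loc {..<n}" using setting by (simp add: camera_setting_def)
  define p q r where "p = loc i - loc j" and "q = loc j - loc k" and "r = loc k - loc i"
  have clean_d: "\<forall>i<n. \<forall>j<n. {i, j} \<in> E0 \<longrightarrow> d i j = (loc i - loc j) /\<^sub>R norm (loc i - loc j)"
    using setting by (simp add: camera_setting_def)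
  have d: "d i j = p /\<^sub>R norm p" "d j k = q /\<^sub>R norm q" "d k i = r /\<^sub>R norm r"
    using clean_d E E0_pair[OF E(1)] E0_pair[OF E(2)] by (simp_all add: p_def q_def r_def)
  have "p \<noteq> 0" "q \<noteq> 0" "r \<noteq> 0"
    using inj_onD[OF inj, of i j] inj_onD[OF inj, of j k] inj_onD[OF inj, of k i] ijk
    by (auto simp: p_def q_def r_def)
  then have pos: "norm p > 0" "norm q > 0" "norm r > 0" by auto
  have cr: "cross3 r p = cross3 q r" "cross3 p q = cross3 q r"
    by (rule cross3_closed_triangle; simp add: p_def q_def r_def)+
  define A where "A = norm (cross3 q r)"
  have h: "tri_h d t {i, j} = A / (norm q * norm r)" "tri_h d t {j, k} = A / (norm r * norm p)"
    "tri_h d t {k, i} = A / (norm p * norm q)"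
    using ijk by (simp_all add: t d A_def cr doubleton_eq_iff cross_mult_left cross_mult_right divide_inverse)
  have "tri_h d t {i, j} > 0"
    using tri_h_pos[of t "{i, j}"] assms V_subset_T t by auto
  moreover have "A \<ge> 0" by (simp add: A_def)
  ultimately have "A > 0" using h(1) by (cases "A = 0") auto
  define s where "s = norm p * norm q * norm r / A"
  have "s > 0" using pos \<open>A > 0\<close> by (simp add: s_def)
  have sh: "s * tri_h d t {i, j} = norm p" "s * tri_h d t {j, k} = norm q" "s * tri_h d t {k, i} = norm r"
    using pos \<open>A > 0\<close> unfolding h s_def by (simp_all add: field_simps)
  have len: "norm (loc a - loc b) = norm (loc a' - loc b')" if "{a, b} = {a', b'}" for a b a' b'
    using that by (auto simp: doubleton_eq_iff norm_minus_commute)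
  have "s * tri_h d t {a, b} = norm (loc a - loc b)" if "{a, b} \<in> tri_edges t" for a b
  proof -
    from that consider "{a, b} = {i, j}" | "{a, b} = {j, k}" | "{a, b} = {k, i}" by (auto simp: t)
    then show ?thesis
    proof cases
      case 1
      with sh(1) len[OF 1] show ?thesis by (simp only: p_def)
    next
      case 2
      with sh(2) len[OF 2] show ?thesis by (simp only: q_def)
    next
      case 3
      with sh(3) len[OF 3] show ?thesis by (simp only: r_def)
    qed
  qed
  with \<open>s > 0\<close> show ?thesis by blast
qed

text \<open>Existence is the law of sines; uniqueness follows from a single edge, because its height
  number is positive.\<close>

lemma s_star:
  assumes "t \<in> V"
  shows "s_star loc d t > 0"
    "{a, b} \<in> tri_edges t \<Longrightarrow> s_star loc d t * tri_h d t {a, b} = norm (loc a - loc b)"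
proof -
  obtain i j k where t: "t = (i, j, k)" by (cases t)
  have "\<exists>!s. s > 0 \<and> (\<forall>a b. {a, b} \<in> tri_edges t \<longrightarrow> s * tri_h d t {a, b} = norm (loc a - loc b))"
  proof -
    obtain s where s: "s > 0" "\<And>a b. {a, b} \<in> tri_edges t \<Longrightarrow> s * tri_h d t {a, b} = norm (loc a - loc b)"
      using law_of_sines[OF assms] by blast
    have "{i, j} \<in> tri_edges t" by (simp add: t)
    then have "tri_h d t {i, j} > 0" using tri_h_pos assms V_subset_T by blast
    then show ?thesis using s \<open>{i, j} \<in> tri_edges t\<close>
      by (intro ex1I[of _ s]) (blast, metis less_irrefl mult_right_cancel)
  qed
  from theI'[OF this] show "s_star loc d t > 0"
    "{a, b} \<in> tri_edges t \<Longrightarrow> s_star loc d t * tri_h d t {a, b} = norm (loc a - loc b)"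
    unfolding s_star_def by blast+
qed

section \<open>Neighbours, residuals and weights of rows\<close>

lemma nbrs_iff: "u \<in> nbrs t \<longleftrightarrow> t \<in> T \<and> u \<in> T \<and> t \<noteq> u \<and> tri_edges t \<inter> tri_edges u \<noteq> {}"
  by (simp add: nbrs_def adjacent_triangles_def)

lemma nbrs_sym: "u \<in> nbrs t \<longleftrightarrow> t \<in> nbrs u"
  by (auto simp: nbrs_iff)

lemma nbrs_subset_T: "nbrs t \<subseteq> T"
  by (auto simp: nbrs_iff)

lemma finite_nbrs [simp]: "finite (nbrs t)"
  by (rule finite_subset[OF nbrs_subset_T finite_T])

lemma row_g_shared_edge:
  assumes "u \<in> nbrs t" "e \<in> tri_edges t" "e \<in> tri_edges u"
  shows "row_g d (t, u) = ln (tri_h d t e) - ln (tri_h d u e)"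
proof -
  have tu: "t \<in> T" "u \<in> T" "t \<noteq> u" using assms nbrs_iff by auto
  have "tri_edges t \<inter> tri_edges u = {e}"
    by (rule shared_edge_unique[of t n u e]) (use assms tu T_triples[of t] T_triples[of u] in auto)
  moreover have "tri_h d t e > 0" "tri_h d u e > 0" using tri_h_pos tu assms by auto
  ultimately show ?thesis by (simp add: ln_div)
qed

text \<open>Makes the arbitrary orientation chosen by \<open>R\<close> harmless.\<close>

lemma res_antisym:
  assumes "u \<in> nbrs t"
  shows "res u t z = - res t u z"
proof -
  obtain e where e: "e \<in> tri_edges t" "e \<in> tri_edges u" using assms nbrs_iff by blast
  have "t \<in> nbrs u" using assms nbrs_sym by blast
  then show ?thesis
    using row_g_shared_edge[OF assms e] row_g_shared_edge[OF _ e(2,1)]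
    by (simp add: res_def del: row_g.simps)
qed

lemma res_diff: "res t u y = res t u x + (y u - x u) - (y t - x t)"
  by (simp add: res_def)

text \<open>Both triangles assign the true length to the shared edge,
  \<open>s_t * h_t = s_u * h_u\<close>; taking logarithms, the offset \<open>row_g\<close> is
  exactly the difference of the true log-scales.\<close>

lemma res_clean:
  assumes "t \<in> V" "u \<in> V" "u \<in> nbrs t"
  shows "res t u z = err z u - err z t"
proof -
  obtain e where e: "e \<in> tri_edges t" "e \<in> tri_edges u" using assms nbrs_iff by blast
  obtain a b where ab: "e = {a, b}"
    using tri_edges_iff[OF T_triples, of t e] e assms V_subset_T by blast
  have h: "tri_h d t e > 0" "tri_h d u e > 0" using tri_h_pos e assms V_subset_T by blast+
  have eq: "s_star loc d t * tri_h d t e = s_star loc d u * tri_h d u e"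
    using s_star(2)[of t a b] s_star(2)[of u a b] assms e ab by simp
  have "ln (s_star loc d t) + ln (tri_h d t e) = ln (s_star loc d u) + ln (tri_h d u e)"
    using arg_cong[OF eq, of ln] h s_star(1)[of t] s_star(1)[of u] assms by (simp add: ln_mult)
  then show ?thesis
    using row_g_shared_edge[OF assms(3) e]
    by (simp add: res_def err_def z_star_def del: row_g.simps)
qed

lemma wt_sym: "wt t u = wt u t"
  by (simp add: wt_def mult.commute)

lemma wt_bounds:
  assumes "t \<in> T" "u \<in> T"
  shows "0 \<le> wt t u" "wt t u \<le> 1"
  using score_nonneg[OF assms(1)] score_nonneg[OF assms(2)] score_le_1[OF assms(1)] score_le_1[OF assms(2)]
  by (auto simp: wt_def intro: mult_le_one)

lemma wt_clean: "t \<in> V \<Longrightarrow> u \<in> V \<Longrightarrow> wt t u = 1"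
  by (simp add: wt_def score_clean)

section \<open>Counting neighbours and corrupted neighbours\<close>

lemma nbr_cases:
  assumes "u \<in> nbrs t"
  obtains a b l where "a \<in> verts t" "b \<in> verts t" "a \<noteq> b" "l < n" "l \<notin> verts t"
    "u = tri a b l" "verts u = {a, b, l}"
proof -
  have tu: "t \<in> triples n" "u \<in> triples n" "t \<noteq> u" using assms nbrs_iff T_triples by auto
  obtain e where e: "e \<in> tri_edges t" "e \<in> tri_edges u" using assms nbrs_iff by blast
  obtain a b where ab: "e = {a, b}" "a \<noteq> b" "a \<in> verts t" "b \<in> verts t"
    using tri_edges_iff[OF tu(1), of e] e by blast
  then show ?thesis using shared_edge_third_vertex[OF tu, of a b] e that by blast
qed

lemma card_nbrs:
  assumes "t \<in> T"
  shows "card (nbrs t) \<le> 3 * n"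
proof -
  obtain i j k where t: "t = (i, j, k)" by (cases t)
  let ?I = "\<lambda>a b. tri a b ` {..<n}"
  have "nbrs t \<subseteq> ?I i j \<union> ?I j k \<union> ?I i k"
  proof
    fix u assume "u \<in> nbrs t"
    then obtain a b l where "a \<in> verts t" "b \<in> verts t" "a \<noteq> b" "l < n" "u = tri a b l"
      by (rule nbr_cases) blast
    then show "u \<in> ?I i j \<union> ?I j k \<union> ?I i k"
      using tri_commute(1) by (auto simp: t)
  qed
  then have "card (nbrs t) \<le> card (?I i j \<union> ?I j k \<union> ?I i k)" by (intro card_mono) auto
  also have "\<dots> \<le> card (?I i j) + card (?I j k) + card (?I i k)"
    by (meson add_right_mono card_Un_le le_trans)
  also have "\<dots> \<le> n + n + n"
    by (intro add_mono) (metis card_image_le card_lessThan finite_lessThan)+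
  finally show ?thesis by simp
qed

lemma card_bad_edges: "v < n \<Longrightarrow> card {e \<in> Eb. v \<in> e} \<le> max_degree n Eb"
  unfolding max_degree_def by (rule Max_ge) auto

lemma card_bad_nbrs_vertex:
  assumes "v < n"
  shows "card {l. {v, l} \<in> Eb} \<le> max_degree n Eb"
proof -
  have "card {l. {v, l} \<in> Eb} = card ((\<lambda>l. {v, l}) ` {l. {v, l} \<in> Eb})"
    by (rule card_image[symmetric]) (auto simp: inj_on_def doubleton_eq_iff)
  also have "\<dots> \<le> card {e \<in> Eb. v \<in> e}"
    using finite_Eb by (intro card_mono) auto
  finally show ?thesis using card_bad_edges[OF assms] by linarith
qed

lemma finite_bad_nbrs_vertex [simp]: "finite {l. {v, l} \<in> Eb}"
  by (rule finite_subset[of _ "{..<n}"]) (use Eb_edges pair_in_edges in auto)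

text \<open>A neighbour keeps a clean edge of \<open>t\<close> and adds two edges to a new vertex,
  so it fails to be clean only if one of these two is corrupted. Three kept edges, two ends each,
  and at most \<open>max_degree n Eb\<close> corrupted edges per end.\<close>

lemma card_bad_nbrs:
  assumes t: "t \<in> V"
  shows "card (nbrs t - V) \<le> 6 * max_degree n Eb"
proof -
  obtain i j k where ijk: "t = (i, j, k)" by (cases t)
  have lt: "i < n" "j < n" "k < n" using verts_less[OF V_triples[OF t]] by (auto simp: ijk)
  let ?I = "\<lambda>a b. tri a b ` {l. {a, l} \<in> Eb}"
  have sub: "nbrs t - V \<subseteq> ?I i j \<union> ?I j i \<union> ?I j k \<union> ?I k j \<union> ?I i k \<union> ?I k i"
  proof
    fix u assume u: "u \<in> nbrs t - V"
    then obtain a b l where abl: "a \<in> verts t" "b \<in> verts t" "a \<noteq> b" "l < n" "l \<notin> verts t" "u = tri a b l"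
      using nbr_cases by (metis DiffD1)
    have "{a, l} \<in> Eb \<or> {b, l} \<in> Eb"
    proof (rule ccontr)
      assume "\<not> ({a, l} \<in> Eb \<or> {b, l} \<in> Eb)"
      moreover have "{a, l} \<in> edges n" "{b, l} \<in> edges n"
        using abl verts_less[OF V_triples[OF t]] pair_in_edges by auto
      ultimately have "{a, l} \<in> E0" "{b, l} \<in> E0" using edges_split by auto
      then have "tri a b l \<in> V"
        using V_pair[OF t abl(1,2,3)] by (intro tri_in_V) (auto simp: insert_commute)
      with u abl show False by simp
    qed
    then have "u \<in> ?I a b \<or> u \<in> ?I b a" using abl(6) tri_commute(1)[of a b l] by blast
    then show "u \<in> ?I i j \<union> ?I j i \<union> ?I j k \<union> ?I k j \<union> ?I i k \<union> ?I k i"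
      using abl(1,2,3) unfolding ijk by auto
  qed
  have I: "card (?I a b) \<le> max_degree n Eb" if "a < n" for a b
    using card_image_le[of "{l. {a, l} \<in> Eb}" "tri a b"] card_bad_nbrs_vertex[OF that] by simp
  have "card (nbrs t - V) \<le> card (?I i j \<union> ?I j i \<union> ?I j k \<union> ?I k j \<union> ?I i k \<union> ?I k i)"
    by (rule card_mono[OF _ sub]) simp
  also have "\<dots> \<le> card (?I i j) + card (?I j i) + card (?I j k) + card (?I k j) + card (?I i k) + card (?I k i)"
    by (meson add_right_mono card_Un_le le_trans)
  also have "\<dots> \<le> 6 * max_degree n Eb"
    using I[OF lt(1), of j] I[OF lt(1), of k] I[OF lt(2), of i] I[OF lt(2), of k] I[OF lt(3), of i] I[OF lt(3), of j]
    by linarith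
  finally show ?thesis .
qed

text \<open>Vertices of \<open>S\<close> are excluded automatically, since \<open>E0\<close> has no loops.\<close>
lemma card_common_clean_nbrs:
  assumes "finite S" "S \<subseteq> {..<n}"
  shows "real n - card S * (1 + \<Delta>) \<le> card {l. l < n \<and> (\<forall>a\<in>S. {l, a} \<in> E0)}"
proof -
  let ?G = "{l. l < n \<and> (\<forall>a\<in>S. {l, a} \<in> E0)}"
  have "{..<n} \<subseteq> ?G \<union> (\<Union>a\<in>S. insert a {l. {a, l} \<in> Eb})"
  proof
    fix l assume "l \<in> {..<n}"
    then have "{l, a} \<in> E0 \<or> l = a \<or> {a, l} \<in> Eb" if "a \<in> S" for a
      using pair_in_edges[of l a] edges_split that assms(2) by (auto simp: insert_commute)
    then show "l \<in> ?G \<union> (\<Union>a\<in>S. insert a {l. {a, l} \<in> Eb})"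
      using \<open>l \<in> {..<n}\<close> by blast
  qed
  then have "card {..<n} \<le> card (?G \<union> (\<Union>a\<in>S. insert a {l. {a, l} \<in> Eb}))"
    by (rule card_mono[rotated]) (use assms in auto)
  also have "\<dots> \<le> card ?G + (\<Sum>a\<in>S. card (insert a {l. {a, l} \<in> Eb}))"
    using card_UN_le[OF assms(1), of "\<lambda>a. insert a {l. {a, l} \<in> Eb}"]
    by (intro le_trans[OF card_Un_le]) simp
  also have "\<dots> \<le> card ?G + (\<Sum>a\<in>S. 1 + max_degree n Eb)"
  proof (intro add_left_mono sum_mono)
    fix a assume "a \<in> S"
    then show "card (insert a {l. {a, l} \<in> Eb}) \<le> 1 + max_degree n Eb"
      using card_bad_nbrs_vertex[of a] assms(2) card_insert_le_m1[of "Suc (max_degree n Eb)" _ a]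
      by (auto simp: subset_eq)
  qed
  finally have "real n \<le> real (card ?G + (\<Sum>a\<in>S. 1 + max_degree n Eb))"
    by (simp only: card_lessThan of_nat_le_iff)
  then show ?thesis by (simp add: algebra_simps)
qed

end

section \<open>Sums over ordered clean vertex triples\<close>

context camera_rows
begin

lemma tri_nbr:
  assumes "{i, j} \<in> E0" "{j, k} \<in> E0" "{k, i} \<in> E0" "{l, j} \<in> E0" "{k, l} \<in> E0" "l \<noteq> i"
  shows "tri l j k \<in> nbrs (tri i j k) \<inter> V"
proof -
  note t = tri_in_V[OF assms(1-3)] and u = tri_in_V[OF assms(4,2,5)]
  have ne: "j \<noteq> k" "i \<noteq> j" "k \<noteq> i" using assms E0_pair by blast+
  have "{j, k} \<in> tri_edges (tri i j k)" "{j, k} \<in> tri_edges (tri l j k)"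
    using tri_edges_pair_iff[OF V_triples[OF t(1)]] tri_edges_pair_iff[OF V_triples[OF u(1)]] t u ne by auto
  moreover have "i \<notin> verts (tri l j k)" using u(2) ne assms(6) by auto
  then have "tri i j k \<noteq> tri l j k" using t(2) by auto
  ultimately show ?thesis using t(1) u(1) V_subset_T nbrs_iff by blast
qed

text \<open>Extension by zero from clean triangles to all ordered vertex triples, the form in which
  \<open>ordered_triple_sum_bound\<close> can exchange single vertices.\<close>

definition lift :: "(triple \<Rightarrow> real) \<Rightarrow> nat \<Rightarrow> nat \<Rightarrow> nat \<Rightarrow> real" where
  "lift p a b c = (if {a, b} \<in> E0 \<and> {b, c} \<in> E0 \<and> {c, a} \<in> E0 then p (tri a b c) else 0)"

lemma lift_commute: "lift p a b c = lift p b a c" "lift p a b c = lift p a c b"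
  using tri_commute[of a b c] by (auto simp: lift_def insert_commute[of _ _ "{}"])

text \<open>Different exchanges produce different clean neighbours, so the left side is a partial
  sum of the right side, whose terms are nonnegative.\<close>

lemma lift_sum_le_nbrs:
  assumes p: "\<And>u. u \<in> V \<Longrightarrow> 0 \<le> p u"
    and ijk: "{i, j} \<in> E0" "{j, k} \<in> E0" "{k, i} \<in> E0"
    and L: "finite L" "L \<inter> {i, j, k} = {}"
  shows "(\<Sum>l\<in>L. lift p l j k + lift p i l k + lift p i j l) \<le> (\<Sum>u\<in>nbrs (tri i j k) \<inter> V. p u)"
proof -
  have flip: "{a, b} = {b, a}" for a b :: nat by auto
  define S where "S a b = {l \<in> L. {l, a} \<in> E0 \<and> {l, b} \<in> E0}" for a b
  define I where "I a b = (\<lambda>l. tri l a b) ` S a b" for a b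
  have part: "(\<Sum>l\<in>L. lift p l a b) = (\<Sum>u\<in>I a b. p u)"
    and v: "\<And>u. u \<in> I a b \<Longrightarrow> \<exists>l. l \<in> L \<and> verts u = {l, a, b}"
    if ab: "{a, b} \<in> E0" for a b
  proof -
    have vt: "verts (tri l a b) = {l, a, b}" if "l \<in> S a b" for l
      using tri_in_V(2)[of l a b] that ab flip[of b l] by (simp add: S_def)
    have nab: "l \<noteq> a" "l \<noteq> b" if "l \<in> S a b" for l
      using that E0_loop by (auto simp: S_def)
    have inj: "inj_on (\<lambda>l. tri l a b) (S a b)"
    proof (rule inj_onI)
      fix l l' assume l: "l \<in> S a b" "l' \<in> S a b" "tri l a b = tri l' a b"
      then have "{l, a, b} = {l', a, b}" using vt[OF l(1)] vt[OF l(2)] by simp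
      then show "l = l'" using nab[OF l(1)] by blast
    qed
    have "(\<Sum>l\<in>L. lift p l a b) = (\<Sum>l\<in>S a b. lift p l a b)"
      by (rule sum.mono_neutral_right) (use L(1) flip in \<open>auto simp: S_def lift_def\<close>)
    also have "\<dots> = (\<Sum>l\<in>S a b. p (tri l a b))"
      by (rule sum.cong) (use ab flip in \<open>auto simp: S_def lift_def\<close>)
    also have "\<dots> = (\<Sum>u\<in>I a b. p u)"
      unfolding I_def by (simp add: sum.reindex[OF inj])
    finally show "(\<Sum>l\<in>L. lift p l a b) = (\<Sum>u\<in>I a b. p u)" .
    show "\<exists>l. l \<in> L \<and> verts u = {l, a, b}" if "u \<in> I a b" for u
      using that vt by (auto simp: I_def S_def)
  qed
  have ik: "{i, k} \<in> E0" using ijk flip[of i k] by simp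
  have ne: "i \<noteq> j" "j \<noteq> k" "k \<noteq> i" using ijk E0_pair by blast+
  have fin: "finite (I a b)" for a b using L(1) by (simp add: I_def S_def)
  \<comment> \<open>The three families are told apart by which of \<open>i\<close>,
    \<open>j\<close>, \<open>k\<close> is missing; the new vertex cannot fill the gap because
    \<open>L\<close> avoids all three.\<close>
  have d1: "I j k \<inter> I i k = {}" "(I j k \<union> I i k) \<inter> I i j = {}"
  proof -
    have m: "i \<notin> verts u \<and> j \<in> verts u \<and> k \<in> verts u" if "u \<in> I j k" for u
      using v[OF ijk(2) that] L(2) ne by auto
    have m': "i \<in> verts u \<and> j \<notin> verts u \<and> k \<in> verts u" if "u \<in> I i k" for u
      using v[OF ik that] L(2) ne by auto
    have m'': "i \<in> verts u \<and> j \<in> verts u \<and> k \<notin> verts u" if "u \<in> I i j" for u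
      using v[OF ijk(1) that] L(2) ne by auto
    show "I j k \<inter> I i k = {}" using m m' by blast
    show "(I j k \<union> I i k) \<inter> I i j = {}" using m m' m'' by blast
  qed
  have sub: "I j k \<union> I i k \<union> I i j \<subseteq> nbrs (tri i j k) \<inter> V"
  proof -
    have "tri l j k \<in> nbrs (tri i j k) \<inter> V" if "l \<in> S j k" for l
      using tri_nbr[of i j k l] ijk that L(2) flip[of k l] by (auto simp: S_def)
    moreover have "tri l i k \<in> nbrs (tri i j k) \<inter> V" if "l \<in> S i k" for l
      using tri_nbr[of j i k l] ijk that L(2) flip[of k l] flip[of k j] flip[of j i] ik tri_commute(1)[of i j k]
      by (auto simp: S_def)
    moreover have "tri l i j \<in> nbrs (tri i j k) \<inter> V" if "l \<in> S i j" for l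
      using tri_nbr[of k i j l] ijk that L(2) flip[of j l] flip[of k j]
        tri_commute(1)[of i k j] tri_commute(2)[of i j k]
      by (auto simp: S_def)
    ultimately show ?thesis by (auto simp: I_def)
  qed
  have "(\<Sum>l\<in>L. lift p l j k + lift p i l k + lift p i j l)
      = (\<Sum>l\<in>L. lift p l j k) + (\<Sum>l\<in>L. lift p l i k) + (\<Sum>l\<in>L. lift p l i j)"
    using lift_commute(1)[of p i _ k] lift_commute(2)[of p i j] lift_commute(1)[of p i _ j]
    by (simp only: sum.distrib)
  also have "\<dots> = (\<Sum>u\<in>I j k \<union> I i k \<union> I i j. p u)"
    using part ijk ik d1 fin by (simp add: sum.union_disjoint)
  also have "\<dots> \<le> (\<Sum>u\<in>nbrs (tri i j k) \<inter> V. p u)"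
    by (rule sum_mono2) (use sub p in auto)
  finally show ?thesis .
qed

definition common :: "nat set \<Rightarrow> nat set" where
  "common S = {l. l < n \<and> (\<forall>a\<in>S. {l, a} \<in> E0)}"

text \<open>Greedy choice of \<open>a\<close>, \<open>b\<close>, \<open>c\<close>: each must have
  clean edges to \<open>S\<close> and to the vertices chosen before, at most 6 + 2 in all. This is
  the 8 in the bound on \<open>N\<close>.\<close>

lemma clean_triple_count:
  assumes S: "finite S" "S \<subseteq> {..<n}" "card S \<le> 6" and N: "0 \<le> N" "N \<le> real n - 8 * (1 + \<Delta>)"
  shows "N ^ 3 \<le> (\<Sum>a\<in>common S. \<Sum>b\<in>common S. \<Sum>c\<in>common S. lift (\<lambda>_. 1) a b c)"
proof -
  have fin: "finite (common S)" for S by (simp add: common_def)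
  have big: "N \<le> card (common S')" if "finite S'" "S' \<subseteq> {..<n}" "card S' \<le> 8" for S'
  proof -
    have "real (card S') * (1 + \<Delta>) \<le> 8 * (1 + \<Delta>)"
      using that(3) by (intro mult_right_mono) auto
    then show ?thesis using card_common_clean_nbrs[OF that(1,2)] N unfolding common_def by linarith
  qed
  have nn: "0 \<le> lift (\<lambda>_. 1) a b c" for a b c by (simp add: lift_def)
  have c1: "card (insert a S') \<le> Suc (card S')" for a and S' :: "nat set"
    by (simp add: card_insert_le_m1)
  have in3: "N \<le> (\<Sum>c\<in>common S. lift (\<lambda>_. 1) a b c)" if ab: "a \<in> common S" "b \<in> common (insert a S)" for a b
  proof -
    let ?S = "insert a (insert b S)"
    have "N \<le> card (common ?S)"
      using ab S c1[of a "insert b S"] c1[of b S] by (intro big) (auto simp: common_def)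
    also have "\<dots> = (\<Sum>c\<in>common ?S. 1)" by simp
    also have "\<dots> = (\<Sum>c\<in>common ?S. lift (\<lambda>_. 1) a b c)"
      using ab(2) by (intro sum.cong) (auto simp: common_def lift_def insert_commute[of _ _ "{}"])
    also have "\<dots> \<le> (\<Sum>c\<in>common S. lift (\<lambda>_. 1) a b c)"
      by (rule sum_mono2) (auto simp: fin nn, auto simp: common_def)
    finally show ?thesis .
  qed
  have in2: "N * N \<le> (\<Sum>b\<in>common S. \<Sum>c\<in>common S. lift (\<lambda>_. 1) a b c)" if a: "a \<in> common S" for a
  proof -
    have "N * N \<le> (\<Sum>b\<in>common (insert a S). N)"
      using mult_right_mono[OF big[of "insert a S"] N(1)] a S c1[of a S] by (auto simp: common_def)
    also have "\<dots> \<le> (\<Sum>b\<in>common (insert a S). \<Sum>c\<in>common S. lift (\<lambda>_. 1) a b c)"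
      by (intro sum_mono in3 a)
    also have "\<dots> \<le> (\<Sum>b\<in>common S. \<Sum>c\<in>common S. lift (\<lambda>_. 1) a b c)"
      by (rule sum_mono2) (auto simp: fin nn sum_nonneg, auto simp: common_def)
    finally show ?thesis .
  qed
  have "N ^ 3 \<le> (\<Sum>a\<in>common S. N * N)"
    using mult_right_mono[OF big[of S], of "N * N"] S N(1) by (simp add: power3_eq_cube algebra_simps)
  also have "\<dots> \<le> (\<Sum>a\<in>common S. \<Sum>b\<in>common S. \<Sum>c\<in>common S. lift (\<lambda>_. 1) a b c)"
    by (intro sum_mono in2)
  finally show ?thesis .
qed

end

section \<open>Oscillation over clean triangles\<close>

locale large_camera_rows = camera_rows +
  assumes n_large: "1000000 \<le> n" and degree_small: "100000 * \<Delta> \<le> real n"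
begin

text \<open>The loss is at most 0.00008 of \<open>n\<close> from the degree and 0.000008 from the
  constant 8, well below 0.001.\<close>

lemma N_bound: "0.999 * real n \<le> real n - 8 * (1 + \<Delta>)"
  using n_large degree_small by simp

lemma V_ordered:
  assumes "t \<in> V"
  obtains i j k where "t = tri i j k" "verts t = {i, j, k}" "{i, j} \<in> E0" "{j, k} \<in> E0" "{k, i} \<in> E0"
proof -
  obtain i j k where t: "t = (i, j, k)" by (cases t)
  then have "verts t = {i, j, k}" by simp
  moreover have "t = tri i j k" using tri_eqI[OF V_triples[OF assms] calculation] by simp
  moreover have "{i, j} \<in> E0" "{j, k} \<in> E0" "{k, i} \<in> E0" using V_edges[OF assms] by (auto simp: t)
  ultimately show ?thesis using that by blast
qed

lemma common_of_two:
  assumes "t \<in> V" "w \<in> V"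
  shows "(0.999 * real n) ^ 3
    \<le> (\<Sum>a\<in>common (verts t \<union> verts w). \<Sum>b\<in>common (verts t \<union> verts w).
        \<Sum>c\<in>common (verts t \<union> verts w). lift (\<lambda>_. 1) a b c)"
proof (rule clean_triple_count)
  show "card (verts t \<union> verts w) \<le> 6"
    using card_Un_le[of "verts t" "verts w"] card_verts[OF V_triples[OF assms(1)]]
      card_verts[OF V_triples[OF assms(2)]] by simp
  show "verts t \<union> verts w \<subseteq> {..<n}" using verts_less V_triples assms by blast
qed (use N_bound in auto)

lemma V_nonempty: "V \<noteq> {}"
proof
  assume "V = {}"
  then have "lift (\<lambda>_. 1) a b c = 0" for a b c using tri_in_V(1)[of a b c] by (auto simp: lift_def)
  moreover have "(0.999 * real n) ^ 3
    \<le> (\<Sum>a\<in>common {}. \<Sum>b\<in>common {}. \<Sum>c\<in>common {}. lift (\<lambda>_. 1) a b c)"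
    by (rule clean_triple_count) (use N_bound in auto)
  ultimately show False using n_large by simp
qed

text \<open>Think of \<open>p\<close> and \<open>q\<close> as the gaps to the maximum and to the
  minimum, so that \<open>D\<close> is the oscillation. Since \<open>p\<close> vanishes at
  \<open>t\<close>, its sum over triangles reachable from \<open>t\<close> in three exchanges is
  small, and likewise for \<open>q\<close> from \<open>w\<close>. Almost all clean triangles are
  reachable from both, and there the gaps add up to \<open>D\<close>.\<close>

lemma clean_oscillation:
  assumes pq: "\<And>u. u \<in> V \<Longrightarrow> 0 \<le> p u" "\<And>u. u \<in> V \<Longrightarrow> 0 \<le> q u" "\<And>u. u \<in> V \<Longrightarrow> p u + q u = D"
    and t: "t \<in> V" "p t = 0" and w: "w \<in> V" "q w = 0"
    and B: "0 \<le> B" "0 \<le> B'"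
    and p_loc: "\<And>u. u \<in> V \<Longrightarrow> (\<Sum>v\<in>nbrs u \<inter> V. p v) \<le> 3.1 * real n * p u + B"
    and q_loc: "\<And>u. u \<in> V \<Longrightarrow> (\<Sum>v\<in>nbrs u \<inter> V. q v) \<le> 3.1 * real n * q u + B'"
  shows "D * real n \<le> 4.3 * (B + B')"
proof -
  let ?F = "common (verts t \<union> verts w)"
  \<comment> \<open>\<open>ordered_triple_sum_bound\<close> with \<beta> = \<open>3.1 * n\<close>
    and \<open>m = n\<close>: the leading term vanishes with the value at \<open>t'\<close>, and
    24.91 = 3.1^2 + 3 * 3.1 + 6.\<close>
  have key: "6 * (\<Sum>a\<in>?F. \<Sum>b\<in>?F. \<Sum>c\<in>?F. lift p a b c) \<le> B * 24.91 * (real n)\<^sup>2"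
    if p: "\<And>u. u \<in> V \<Longrightarrow> 0 \<le> p u" and t: "t' \<in> V" "p t' = 0" and tF: "?F \<subseteq> common (verts t')" and B: "0 \<le> B"
      and loc: "\<And>u. u \<in> V \<Longrightarrow> (\<Sum>v\<in>nbrs u \<inter> V. p v) \<le> 3.1 * real n * p u + B"
    for p t' B
  proof -
    obtain i j k where ijk: "t' = tri i j k" "verts t' = {i, j, k}" and E: "{i, j} \<in> E0" "{j, k} \<in> E0" "{k, i} \<in> E0"
      using V_ordered[OF t(1)] .
    have "6 * (\<Sum>a\<in>?F. \<Sum>b\<in>?F. \<Sum>c\<in>?F. lift p a b c)
        \<le> (3.1 * real n)^3 * lift p i j k + B * ((3.1 * real n)\<^sup>2 + 3 * real n * (3.1 * real n) + 6 * (real n)\<^sup>2)"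
    proof (rule ordered_triple_sum_bound[where E = E0 and P = "lift p"])
      show "0 \<le> lift p a b c" for a b c using p[OF tri_in_V(1)[of a b c]] by (simp add: lift_def)
      show "lift p a b c = lift p b a c" "lift p a b c = lift p a c b" for a b c by (rule lift_commute)+
      show "lift p a b c = 0" if "\<not> ({a, b} \<in> E0 \<and> {b, c} \<in> E0 \<and> {c, a} \<in> E0)" for a b c
        using that by (auto simp: lift_def)
      show "{a, a} \<notin> E0" for a by (rule E0_loop)
      show "(\<Sum>l\<in>L. lift p l j k + lift p i l k + lift p i j l) \<le> 3.1 * real n * lift p i j k + B"
        if E: "{i, j} \<in> E0" "{j, k} \<in> E0" "{k, i} \<in> E0" and L: "finite L" "L \<inter> {i, j, k} = {}" for i j k L
      proof -
        have "lift p i j k = p (tri i j k)" using E by (simp add: lift_def)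
        then show ?thesis
          using lift_sum_le_nbrs[of p, OF p E L] loc[OF tri_in_V(1)[OF E]] by simp
      qed
      show "finite ?F" by (simp add: common_def)
      have "card ?F \<le> card {..<n}" by (rule card_mono) (auto simp: common_def)
      then show "real (card ?F) \<le> real n" by simp
      show "{l, i} \<in> E0 \<and> {l, j} \<in> E0 \<and> {l, k} \<in> E0" if "l \<in> ?F" for l
      proof -
        have "l \<in> common {i, j, k}" using that tF unfolding ijk(2) by blast
        then show ?thesis by (simp add: common_def)
      qed
    qed (use E B in auto)
    also have "lift p i j k = 0" using t ijk E by (simp add: lift_def)
    finally show ?thesis by (simp add: power2_eq_square algebra_simps)
  qed
  have kp: "6 * (\<Sum>a\<in>?F. \<Sum>b\<in>?F. \<Sum>c\<in>?F. lift p a b c) \<le> B * 24.91 * (real n)\<^sup>2"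
    by (rule key[OF pq(1) t _ B(1) p_loc]) (auto simp: common_def)
  have kq: "6 * (\<Sum>a\<in>?F. \<Sum>b\<in>?F. \<Sum>c\<in>?F. lift q a b c) \<le> B' * 24.91 * (real n)\<^sup>2"
    by (rule key[OF pq(2) w _ B(2) q_loc]) (auto simp: common_def)
  have D: "0 \<le> D" using pq[OF t(1)] by linarith
  have "lift p a b c + lift q a b c = D * lift (\<lambda>_. 1) a b c" for a b c
    using pq(3) tri_in_V(1)[of a b c] by (auto simp: lift_def)
  then have "(\<Sum>a\<in>?F. \<Sum>b\<in>?F. \<Sum>c\<in>?F. lift p a b c) + (\<Sum>a\<in>?F. \<Sum>b\<in>?F. \<Sum>c\<in>?F. lift q a b c)
     = D * (\<Sum>a\<in>?F. \<Sum>b\<in>?F. \<Sum>c\<in>?F. lift (\<lambda>_. 1) a b c)"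
    by (simp add: sum.distrib[symmetric] sum_distrib_left)
  moreover have "D * (0.999 * real n) ^ 3 \<le> D * (\<Sum>a\<in>?F. \<Sum>b\<in>?F. \<Sum>c\<in>?F. lift (\<lambda>_. 1) a b c)"
    using common_of_two[OF t(1) w(1)] D by (rule mult_left_mono)
  ultimately have "6 * (D * (0.999 * real n) ^ 3) \<le> 24.91 * (real n)\<^sup>2 * (B + B')"
    using kp kq by (simp add: distrib_left distrib_right mult.commute mult.left_commute)
  then have "(6 * 0.999^3 * (D * real n)) * (real n)\<^sup>2 \<le> (24.91 * (B + B')) * (real n)\<^sup>2"
    by (simp add: power2_eq_square power3_eq_cube algebra_simps)
  then have "6 * 0.999^3 * (D * real n) \<le> 24.91 * (B + B')"
    by (rule mult_right_le_imp_le) (use n_large in simp)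
  \<comment> \<open>24.91 / (6 * 0.999^3) is about 4.17.\<close>
  moreover have "24.91 * (B + B') \<le> 6 * 0.999^3 * (4.3 * (B + B'))"
    using B by (simp add: power3_eq_cube)
  ultimately have "6 * 0.999^3 * (D * real n) \<le> 6 * 0.999^3 * (4.3 * (B + B'))" by (rule order_trans)
  then show ?thesis by (rule mult_left_le_imp_le) simp
qed

text \<open>Three exchanges lead from \<open>t\<close>, and three from \<open>w\<close>, to one
  clean triangle \<open>a b c\<close> whose vertices are joined to both by clean edges.\<close>

lemma clean_path_bound:
  fixes f :: "triple \<Rightarrow> real"
  assumes step: "\<And>u v. u \<in> V \<Longrightarrow> v \<in> nbrs u \<inter> V \<Longrightarrow> \<bar>f v - f u\<bar> \<le> \<epsilon>"
    and t: "t \<in> V" and w: "w \<in> V"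
  shows "\<bar>f t - f w\<bar> \<le> 6 * \<epsilon>"
proof -
  let ?F = "common (verts t \<union> verts w)"
  have "\<exists>a\<in>?F. \<exists>b\<in>?F. \<exists>c\<in>?F. lift (\<lambda>_. 1) a b c \<noteq> 0"
  proof (rule ccontr)
    assume "\<not> ?thesis"
    then have "(\<Sum>a\<in>?F. \<Sum>b\<in>?F. \<Sum>c\<in>?F. lift (\<lambda>_. 1) a b c) = 0" by (simp add: sum.neutral)
    then show False using common_of_two[OF t w] n_large by simp
  qed
  then obtain a b c where abc: "a \<in> ?F" "b \<in> ?F" "c \<in> ?F" "{a, b} \<in> E0" "{b, c} \<in> E0" "{c, a} \<in> E0"
    by (auto simp: lift_def split: if_splits)
  have flip: "{a, b} = {b, a}" for a b :: nat by auto
  have half: "\<bar>f (tri a b c) - f t\<bar> \<le> 3 * \<epsilon>" if t: "t \<in> V" and F: "?F \<subseteq> common (verts t)" for t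
  proof -
    obtain i j k where ijk: "t = tri i j k" "verts t = {i, j, k}" and E: "{i, j} \<in> E0" "{j, k} \<in> E0" "{k, i} \<in> E0"
      using V_ordered[OF t] .
    have C: "{l, i} \<in> E0" "{l, j} \<in> E0" "{l, k} \<in> E0" "l \<noteq> i" "l \<noteq> j" "l \<noteq> k" if "l \<in> {a, b, c}" for l
    proof -
      have "l \<in> common {i, j, k}" using abc that F ijk(2) by auto
      then show "{l, i} \<in> E0" "{l, j} \<in> E0" "{l, k} \<in> E0" by (auto simp: common_def)
      then show "l \<noteq> i" "l \<noteq> j" "l \<noteq> k" using E0_pair by blast+
    qed
    have 1: "tri a j k \<in> nbrs (tri i j k) \<inter> V"
      using C[of a] E flip[of k a] by (intro tri_nbr) auto
    have 2: "tri b a k \<in> nbrs (tri j a k) \<inter> V"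
      using C[of a] C[of b] E abc flip[of b a] flip[of j a] flip[of k a] flip[of k b] flip[of k j]
      by (intro tri_nbr) auto
    have 3: "tri c a b \<in> nbrs (tri k a b) \<inter> V"
      using C[of a] C[of b] C[of c] E abc flip[of k a] flip[of c b]
      by (intro tri_nbr) auto
    have e: "tri j a k = tri a j k" "tri k a b = tri b a k" "tri c a b = tri a b c"
      using tri_commute(1)[of a j k] tri_commute tri_commute(2)[of b a k] by metis+
    have "\<bar>f (tri a j k) - f t\<bar> \<le> \<epsilon>" using step[OF t] 1 ijk(1) by blast
    moreover have "\<bar>f (tri b a k) - f (tri a j k)\<bar> \<le> \<epsilon>" using step 1 2 e(1) by fastforce
    moreover have "\<bar>f (tri a b c) - f (tri b a k)\<bar> \<le> \<epsilon>" using step 2 3 e(2,3) by fastforce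
    ultimately show ?thesis by linarith
  qed
  have "\<bar>f (tri a b c) - f t\<bar> \<le> 3 * \<epsilon>" "\<bar>f (tri a b c) - f w\<bar> \<le> 3 * \<epsilon>"
    by (intro half t w; auto simp: common_def)+
  then show ?thesis by linarith
qed

text \<open>Weights are bounded below on the neighbours and above at the centre, which has at most
  \<open>3 * n\<close> neighbours. Dividing by 100/101 gives the factor 1.01, and 1.01 * (3 + 1/28)
  is below 3.1.\<close>

lemma weighted_to_plain:
  assumes p: "\<And>u. u \<in> V \<Longrightarrow> 0 \<le> p u"
    and om: "\<And>u v. u \<in> V \<Longrightarrow> v \<in> nbrs u \<inter> V \<Longrightarrow> 100/101 \<le> om u v \<and> om u v \<le> 1"
    and \<mu>: "\<mu> \<le> real n / 28"
    and u: "u \<in> V"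
    and super: "- B \<le> \<mu> * p u + (\<Sum>v\<in>nbrs u \<inter> V. om u v * (p u - p v))"
  shows "(\<Sum>v\<in>nbrs u \<inter> V. p v) \<le> 3.1 * real n * p u + max 0 (1.01 * B)"
proof -
  let ?N = "nbrs u \<inter> V"
  have c: "real (card ?N) \<le> 3 * real n"
  proof -
    have "card ?N \<le> card (nbrs u)" by (rule card_mono) auto
    also have "\<dots> \<le> 3 * n" using card_nbrs u V_subset_T by blast
    finally show ?thesis by (metis of_nat_le_iff of_nat_mult of_nat_numeral)
  qed
  have "100/101 * (\<Sum>v\<in>?N. p v) \<le> (\<Sum>v\<in>?N. om u v * p v)"
    unfolding sum_distrib_left using om[OF u] p by (intro sum_mono mult_right_mono) auto
  also have "\<dots> \<le> \<mu> * p u + (\<Sum>v\<in>?N. om u v) * p u + B"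
    using super by (simp add: right_diff_distrib sum_subtractf sum_distrib_right)
  also have "\<dots> \<le> real n / 28 * p u + 3 * real n * p u + B"
  proof -
    have "(\<Sum>v\<in>?N. om u v) \<le> (\<Sum>v\<in>?N. 1)" using om[OF u] by (intro sum_mono) auto
    then have "(\<Sum>v\<in>?N. om u v) \<le> 3 * real n" using c by simp
    then show ?thesis using \<mu> p[OF u] by (intro add_mono mult_right_mono) auto
  qed
  finally have "(\<Sum>v\<in>?N. p v) \<le> 1.01 * (real n / 28 + 3 * real n) * p u + 1.01 * B"
    by (simp add: algebra_simps)
  moreover have "1.01 * (real n / 28 + 3 * real n) * p u \<le> 3.1 * real n * p u"
    using p[OF u] by (intro mult_right_mono) auto
  ultimately show ?thesis by linarith
qed

text \<open>Two one-sided inequalities with separate budgets suffice, which lets the overshoot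
  argument charge more to the lower end than to the upper one. The constant is 4.3 * 1.01.\<close>

lemma oscillation_bound:
  assumes om: "\<And>u v. u \<in> V \<Longrightarrow> v \<in> nbrs u \<inter> V \<Longrightarrow> 100/101 \<le> om u v \<and> om u v \<le> 1"
    and \<mu>: "\<mu> \<le> real n / 28" and B: "0 \<le> B" "0 \<le> B'"
    and t: "t \<in> V" "\<And>u. u \<in> V \<Longrightarrow> y u \<le> y t" and w: "w \<in> V" "\<And>u. u \<in> V \<Longrightarrow> y w \<le> y u"
    and up: "\<And>u. u \<in> V \<Longrightarrow> - B \<le> \<mu> * (y t - y u) + (\<Sum>v\<in>nbrs u \<inter> V. om u v * (y v - y u))"
    and down: "\<And>u. u \<in> V \<Longrightarrow> - B' \<le> \<mu> * (y u - y w) + (\<Sum>v\<in>nbrs u \<inter> V. om u v * (y u - y v))"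
  shows "(y t - y w) * real n \<le> 4343/1000 * (B + B')"
proof -
  have "(y t - y w) * real n \<le> 4.3 * (max 0 (1.01 * B) + max 0 (1.01 * B'))"
  proof (rule clean_oscillation[where p = "\<lambda>u. y t - y u" and q = "\<lambda>u. y u - y w" and t = t and w = w])
    show "(\<Sum>v\<in>nbrs u \<inter> V. y t - y v) \<le> 3.1 * real n * (y t - y u) + max 0 (1.01 * B)" if "u \<in> V" for u
      by (rule weighted_to_plain[OF _ om \<mu> that]) (use t up[OF that] in \<open>auto simp: algebra_simps\<close>)
    show "(\<Sum>v\<in>nbrs u \<inter> V. y v - y w) \<le> 3.1 * real n * (y u - y w) + max 0 (1.01 * B')" if "u \<in> V" for u
      by (rule weighted_to_plain[OF _ om \<mu> that]) (use w down[OF that] in \<open>auto simp: algebra_simps\<close>)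
  qed (use t w in auto)
  then show ?thesis using B by simp
qed

lemma V_extrema:
  fixes y :: "triple \<Rightarrow> real"
  obtains t w where "t \<in> V" "\<And>u. u \<in> V \<Longrightarrow> y u \<le> y t" "w \<in> V" "\<And>u. u \<in> V \<Longrightarrow> y w \<le> y u"
proof -
  have "Max (y ` V) \<in> y ` V" "Min (y ` V) \<in> y ` V" using V_nonempty by (auto intro: Max_in Min_in)
  then obtain t w where tw: "t \<in> V" "y t = Max (y ` V)" "w \<in> V" "y w = Min (y ` V)"
    by (metis imageE)
  show ?thesis by (rule that[of t w]) (use tw in auto)
qed

lemma stationary_oscillation:
  assumes om: "\<And>u v. u \<in> V \<Longrightarrow> v \<in> nbrs u \<inter> V \<Longrightarrow> 100/101 \<le> om u v \<and> om u v \<le> 1"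
    and b: "\<And>u. u \<in> V \<Longrightarrow> \<bar>b u\<bar> \<le> B"
    and eq: "\<And>u. u \<in> V \<Longrightarrow> (\<Sum>v\<in>nbrs u \<inter> V. om u v * (y v - y u)) + b u = 0"
    and tw: "t \<in> V" "w \<in> V"
  shows "(y t - y w) * real n \<le> 8.7 * B"
proof -
  obtain t' w' where ext: "t' \<in> V" "\<And>u. u \<in> V \<Longrightarrow> y u \<le> y t'" "w' \<in> V" "\<And>u. u \<in> V \<Longrightarrow> y w' \<le> y u"
    by (rule V_extrema[of y]) blast
  have B: "0 \<le> B" using b[OF tw(1)] by linarith
  have neg: "(\<Sum>v\<in>nbrs u \<inter> V. om u v * (y u - y v)) = - (\<Sum>v\<in>nbrs u \<inter> V. om u v * (y v - y u))" for u
    by (simp add: sum_negf[symmetric] algebra_simps)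
  have "(y t - y w) * real n \<le> (y t' - y w') * real n"
    using ext tw by (intro mult_right_mono diff_mono) auto
  also have "(y t' - y w') * real n \<le> 4343/1000 * (B + B)"
  proof (rule oscillation_bound[OF om _ B B ext, where \<mu> = 0])
    show "- B \<le> 0 * (y t' - y u) + (\<Sum>v\<in>nbrs u \<inter> V. om u v * (y v - y u))" if "u \<in> V" for u
      using b[OF that] eq[OF that] by linarith
    show "- B \<le> 0 * (y u - y w') + (\<Sum>v\<in>nbrs u \<inter> V. om u v * (y u - y v))" if "u \<in> V" for u
      using b[OF that] eq[OF that] neg[of u] by linarith
  qed auto
  also have "4343/1000 * (B + B) \<le> 8.7 * B" using B by simp
  finally show ?thesis .
qed

text \<open>If the maximum of \<open>y\<close> exceeds the window \<open>[a, a + r]\<close> by \<open>s\<close>, then evaluating the equation there gives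
  \<open>\<mu> s \<le> B\<close>. Sliding the window up by \<open>s\<close> therefore only adds \<open>B\<close> to the forcing, which is harmless,
  whereas an overshoot \<open>s = B / \<mu>\<close> added to the oscillation would not be.\<close>
lemma prox_oscillation_overshoot:
  assumes om: "\<And>u v. u \<in> V \<Longrightarrow> v \<in> nbrs u \<inter> V \<Longrightarrow> 100/101 \<le> om u v \<and> om u v \<le> 1"
    and \<mu>: "0 \<le> \<mu>" "\<mu> \<le> real n / 28"
    and b: "\<And>u. u \<in> V \<Longrightarrow> \<bar>b u\<bar> \<le> B"
    and eq: "\<And>u. u \<in> V \<Longrightarrow> \<mu> * (y u - x u) = (\<Sum>v\<in>nbrs u \<inter> V. om u v * (y v - y u)) + b u"
    and x: "\<And>u. u \<in> V \<Longrightarrow> a \<le> x u \<and> x u \<le> a + r"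
    and r: "13.1 * B \<le> r * real n"
    and over: "t0 \<in> V" "a + r < y t0"
    and tw: "t \<in> V" "w \<in> V"
  shows "y t - y w \<le> r"
proof -
  obtain t' w' where ext: "t' \<in> V" "\<And>u. u \<in> V \<Longrightarrow> y u \<le> y t'" "w' \<in> V" "\<And>u. u \<in> V \<Longrightarrow> y w' \<le> y u"
    by (rule V_extrema[of y]) blast
  have B: "0 \<le> B" using b[OF tw(1)] by linarith
  define s where "s = y t' - a - r"
  have s: "s > 0" using over ext(2)[OF over(1)] by (simp add: s_def)
  have \<mu>s: "\<mu> * s \<le> B"
  proof -
    have "(\<Sum>v\<in>nbrs t' \<inter> V. om t' v * (y v - y t')) \<le> 0"
    proof (rule sum_nonpos)
      fix v assume v: "v \<in> nbrs t' \<inter> V"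
      then have "0 \<le> om t' v" "y v - y t' \<le> 0" using om[OF ext(1) v] ext(2) by auto
      then show "om t' v * (y v - y t') \<le> 0" by (rule mult_nonneg_nonpos)
    qed
    then have "\<mu> * (y t' - x t') \<le> B" using eq[OF ext(1)] b[OF ext(1)] by linarith
    moreover have "\<mu> * s \<le> \<mu> * (y t' - x t')"
      using \<mu>(1) x[OF ext(1)] by (intro mult_left_mono) (auto simp: s_def)
    ultimately show ?thesis by linarith
  qed
  have "y t' - y w' \<le> r"
  proof (rule ccontr)
    assume "\<not> y t' - y w' \<le> r"
    then have far: "y t' - y w' > r" by simp
    have neg: "(\<Sum>v\<in>nbrs u \<inter> V. om u v * (y u - y v)) = - (\<Sum>v\<in>nbrs u \<inter> V. om u v * (y v - y u))" for u
      by (simp add: sum_negf[symmetric] algebra_simps)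
    have "r * real n < (y t' - y w') * real n" using far n_large by simp
    also have "(y t' - y w') * real n \<le> 4343/1000 * (B + 2 * B)"
    proof (rule oscillation_bound[OF om \<mu>(2) B _ ext])
      fix u assume u: "u \<in> V"
      have "0 \<le> \<mu> * (y t' - x u)"
        using x[OF u] s \<mu>(1) by (intro mult_nonneg_nonneg) (auto simp: s_def)
      then show "- B \<le> \<mu> * (y t' - y u) + (\<Sum>v\<in>nbrs u \<inter> V. om u v * (y v - y u))"
        using eq[OF u] b[OF u] by (simp add: algebra_simps)
      \<comment> \<open>If the oscillation exceeds \<open>r\<close>, the minimum of \<open>y\<close>
        lies below \<open>a + s\<close>, so it exceeds no old value by more than \<open>s\<close>;
        the cost \<open>\<mu> * s\<close> is at most another \<open>B\<close>.\<close>
      have "\<mu> * (- s) \<le> \<mu> * (x u - y w')"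
        using x[OF u] far \<mu>(1) by (intro mult_left_mono) (auto simp: s_def)
      then show "- (2 * B) \<le> \<mu> * (y u - y w') + (\<Sum>v\<in>nbrs u \<inter> V. om u v * (y u - y v))"
        unfolding neg using eq[OF u] b[OF u] \<mu>s by (simp add: algebra_simps)
    qed (use B in auto)
    \<comment> \<open>3 * 4.343 = 13.029.\<close>
    also have "4343/1000 * (B + 2 * B) \<le> 13.1 * B" using B by simp
    also have "\<dots> \<le> r * real n" by (rule r)
    finally show False by simp
  qed
  moreover have "y t - y w \<le> y t' - y w'" using ext tw by (intro diff_mono) auto
  ultimately show ?thesis by linarith
qed

text \<open>The window starts at the old minimum. Leaving it below reduces to leaving it above by
  changing the sign of \<open>x\<close>, \<open>y\<close> and \<open>b\<close>; staying inside needs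
  no equation at all.\<close>

lemma prox_oscillation:
  assumes om: "\<And>u v. u \<in> V \<Longrightarrow> v \<in> nbrs u \<inter> V \<Longrightarrow> 100/101 \<le> om u v \<and> om u v \<le> 1"
    and \<mu>: "0 \<le> \<mu>" "\<mu> \<le> real n / 28"
    and b: "\<And>u. u \<in> V \<Longrightarrow> \<bar>b u\<bar> \<le> B"
    and eq: "\<And>u. u \<in> V \<Longrightarrow> \<mu> * (y u - x u) = (\<Sum>v\<in>nbrs u \<inter> V. om u v * (y v - y u)) + b u"
    and x: "\<And>u v. u \<in> V \<Longrightarrow> v \<in> V \<Longrightarrow> x u - x v \<le> r"
    and r: "13.1 * B \<le> r * real n"
    and tw: "t \<in> V" "w \<in> V"
  shows "y t - y w \<le> r"
proof -
  obtain w0 where w0: "w0 \<in> V" "\<And>u. u \<in> V \<Longrightarrow> x w0 \<le> x u" using V_extrema[of x] by metis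
  define a where "a = x w0"
  have xa: "a \<le> x u \<and> x u \<le> a + r" if "u \<in> V" for u
    using w0(2)[OF that] x[OF that w0(1)] by (simp add: a_def)
  consider (over) t0 where "t0 \<in> V" "a + r < y t0" | (under) t0 where "t0 \<in> V" "y t0 < a"
    | (inside) "\<And>u. u \<in> V \<Longrightarrow> a \<le> y u \<and> y u \<le> a + r"
    by (meson not_le)
  then show ?thesis
  proof cases
    case over
    show ?thesis by (rule prox_oscillation_overshoot[OF om \<mu> b eq xa r over tw])
  next
    case under
    have neg: "(\<Sum>v\<in>nbrs u \<inter> V. om u v * (- y v - - y u)) = - (\<Sum>v\<in>nbrs u \<inter> V. om u v * (y v - y u))" for u
      by (simp add: sum_negf[symmetric] algebra_simps)
    have "- y w - - y t \<le> r"
    proof (rule prox_oscillation_overshoot[OF om \<mu>, where b = "\<lambda>u. - b u" and y = "\<lambda>u. - y u"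
          and x = "\<lambda>u. - x u" and a = "- a - r" and ?t0.0 = t0])
      show "\<mu> * (- y u - - x u) = (\<Sum>v\<in>nbrs u \<inter> V. om u v * (- y v - - y u)) + - b u" if "u \<in> V" for u
        unfolding neg using eq[OF that] by (simp add: algebra_simps)
          show "- a - r \<le> - x u \<and> - x u \<le> - a - r + r" if "u \<in> V" for u using xa[OF that] by linarith
    qed (use b r under tw in auto)
    then show ?thesis by simp
  next
    case inside
    show ?thesis using inside[OF tw(1)] inside[OF tw(2)] by linarith
  qed
qed

end

section \<open>The proximal map\<close>

lemma cauchy_weight_pos: "0 < cauchy_weight \<sigma> r"
  by (simp add: cauchy_weight_def add_pos_nonneg)

lemma cauchy_weight_le_1: "cauchy_weight \<sigma> r \<le> 1"
  by (simp add: cauchy_weight_def divide_le_eq_1 add_pos_nonneg)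

lemma cauchy_weight_uminus [simp]: "cauchy_weight \<sigma> (- r) = cauchy_weight \<sigma> r"
  by (simp add: cauchy_weight_def)

text \<open>AM-GM: \<open>2 * \<sigma> * \<bar>r\<bar>\<close> is at most the sum of the squares in
  the denominator. The bound does not depend on \<open>r\<close>, which is what tames corrupted
  rows.\<close>

lemma cauchy_influence_le:
  assumes "0 < \<sigma>"
  shows "cauchy_weight \<sigma> r * \<bar>r\<bar> \<le> \<sigma> / 2"
proof -
  have "0 \<le> (\<sigma> - \<bar>r\<bar>)\<^sup>2" by simp
  then have "2 * (\<sigma> * \<bar>r\<bar>) \<le> \<sigma>\<^sup>2 + r\<^sup>2" by (simp add: power2_diff)
  moreover have "cauchy_weight \<sigma> r * \<bar>r\<bar> = \<sigma>\<^sup>2 * \<bar>r\<bar> / (\<sigma>\<^sup>2 + r\<^sup>2)"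
    using assms by (simp add: cauchy_weight_def field_simps power2_eq_square)
  moreover have "0 < \<sigma>\<^sup>2 + r\<^sup>2" using assms by (simp add: add_pos_nonneg)
  moreover have "\<sigma> * (2 * (\<sigma> * \<bar>r\<bar>)) \<le> \<sigma> * (\<sigma>\<^sup>2 + r\<^sup>2)"
    using calculation(1) assms by (intro mult_left_mono) auto
  ultimately show ?thesis
    by (simp add: pos_divide_le_eq power2_eq_square mult.assoc)
qed

lemma cauchy_weight_ge:
  assumes "0 < \<sigma>" "\<bar>r\<bar> \<le> \<sigma> / 10"
  shows "100/101 \<le> cauchy_weight \<sigma> r"
proof -
  have "\<bar>r / \<sigma>\<bar> \<le> 1/10" using assms by (simp add: abs_divide field_simps)
  then have "\<bar>r / \<sigma>\<bar>\<^sup>2 \<le> (1/10)\<^sup>2" by (rule power_mono) simp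
  then have "(r / \<sigma>)\<^sup>2 \<le> 1/100" by (simp add: power2_eq_square)
  then show ?thesis unfolding cauchy_weight_def
    by (simp add: pos_le_divide_eq add_pos_nonneg)
qed

text \<open>The potential whose derivative in \<open>r\<close> is the influence
  \<open>cauchy_weight \<sigma> r * r\<close>.\<close>

definition cauchy_loss :: "real \<Rightarrow> real \<Rightarrow> real" where
  "cauchy_loss \<sigma> r = \<sigma>\<^sup>2 / 2 * ln (1 + (r / \<sigma>)\<^sup>2)"

lemma cauchy_loss_nonneg: "0 \<le> cauchy_loss \<sigma> r"
  by (simp add: cauchy_loss_def)

text \<open>The loss is a concave function of the squared residual, so it lies below its tangent
  there; the slope of the tangent is half the Cauchy weight.\<close>

lemma cauchy_loss_majorized:
  assumes "0 < \<sigma>"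
  shows "cauchy_loss \<sigma> s - cauchy_loss \<sigma> r \<le> 1/2 * cauchy_weight \<sigma> r * (s\<^sup>2 - r\<^sup>2)"
proof -
  define A B where "A = 1 + (r / \<sigma>)\<^sup>2" and "B = 1 + (s / \<sigma>)\<^sup>2"
  have pos: "0 < A" "0 < B" by (simp_all add: A_def B_def add_pos_nonneg)
  have "ln B - ln A \<le> (B - A) / A" using ln_diff_le[OF pos(2,1)] .
  then have "\<sigma>\<^sup>2 / 2 * (ln B - ln A) \<le> \<sigma>\<^sup>2 / 2 * ((B - A) / A)"
    by (rule mult_left_mono) simp
  also have "\<dots> = 1/2 * (1 / A) * (s\<^sup>2 - r\<^sup>2)"
  proof -
    have "B - A = (s\<^sup>2 - r\<^sup>2) / \<sigma>\<^sup>2" by (simp add: A_def B_def power_divide diff_divide_distrib)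
    then show ?thesis using assms pos by simp
  qed
  finally show ?thesis by (simp add: cauchy_loss_def cauchy_weight_def A_def B_def right_diff_distrib)
qed

lemma linear_coeff_zero_if_quadratic_nonneg:
  fixes G H :: real
  assumes "\<And>s. 0 \<le> s * G + s\<^sup>2 * H"
  shows "G = 0"
proof (rule ccontr)
  assume "G \<noteq> 0"
  define K where "K = \<bar>H\<bar> + 1"
  have K: "K > 0" "H < K" by (auto simp: K_def)
  have "0 \<le> (- G / K) * G + (- G / K)\<^sup>2 * H" by (rule assms)
  also have "\<dots> = G\<^sup>2 / K * (H / K - 1)" using K by (simp add: field_simps power2_eq_square)
  also have "\<dots> < 0" using K \<open>G \<noteq> 0\<close> by (intro mult_pos_neg) auto
  finally show False by simp
qed

section \<open>Existence and stationarity of the proximal step\<close>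

context camera_rows
begin

lemma R_subset: "R \<subseteq> adjacent_triangles n d"
  using rows by (simp add: row_system_def)

lemma finite_R [simp]: "finite R"
  by (rule finite_subset[of _ "T \<times> T"]) (use R_subset in \<open>auto simp: adjacent_triangles_def\<close>)

lemma R_T: "f \<in> R \<Longrightarrow> fst f \<in> T \<and> snd f \<in> T"
  using R_subset by (auto simp: adjacent_triangles_def)

lemma base_weight_nonneg: "f \<in> R \<Longrightarrow> 0 \<le> base_weight score f"
  using R_T[of f] score_nonneg by (cases f) auto

lemma residual_eq: "residual d f z = z (snd f) - z (fst f) - row_g d f"
  by (cases f) simp

lemma R_orient: "u \<in> nbrs t \<Longrightarrow> (t, u) \<in> R \<longleftrightarrow> (u, t) \<notin> R"
  using rows by (auto simp: row_system_def nbrs_def)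

text \<open>The form taken by a partial derivative of a row sum. Each neighbour contributes one row,
  incoming or outgoing, and antisymmetry gives both kinds the same sign.\<close>

lemma rows_sum_at:
  assumes anti: "\<And>t u. u \<in> nbrs t \<Longrightarrow> \<Phi> u t = - \<Phi> t u"
  shows "(\<Sum>f\<in>R. \<Phi> (fst f) (snd f) * (of_bool (snd f = t) - of_bool (fst f = t))) = - (\<Sum>u\<in>nbrs t. \<Phi> t u :: real)"
proof -
  let ?O = "{u \<in> nbrs t. (t, u) \<in> R}" and ?I = "{u \<in> nbrs t. (u, t) \<in> R}"
  have RN: "u \<in> nbrs t" if "(t, u) \<in> R" for u using that R_subset by (auto simp: nbrs_def)
  have RN': "u \<in> nbrs t" if "(u, t) \<in> R" for u using that R_subset nbrs_sym[of t u] by (auto simp: nbrs_def)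
  have "(\<Sum>f\<in>R. \<Phi> (fst f) (snd f) * of_bool (snd f = t)) = (\<Sum>f\<in>(\<lambda>u. (u, t)) ` ?I. \<Phi> (fst f) (snd f))"
    by (rule sum.mono_neutral_cong_right) (use RN' in \<open>auto simp: image_iff\<close>)
  also have "\<dots> = (\<Sum>u\<in>?I. \<Phi> u t)" by (subst sum.reindex) (auto simp: inj_on_def)
  also have "\<dots> = - (\<Sum>u\<in>?I. \<Phi> t u)"
    using anti by (simp add: sum_negf)
  finally have i: "(\<Sum>f\<in>R. \<Phi> (fst f) (snd f) * of_bool (snd f = t)) = - (\<Sum>u\<in>?I. \<Phi> t u)" .
  have "(\<Sum>f\<in>R. \<Phi> (fst f) (snd f) * of_bool (fst f = t)) = (\<Sum>f\<in>(\<lambda>u. (t, u)) ` ?O. \<Phi> (fst f) (snd f))"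
    by (rule sum.mono_neutral_cong_right) (use RN in \<open>auto simp: image_iff\<close>)
  also have "\<dots> = (\<Sum>u\<in>?O. \<Phi> t u)" by (subst sum.reindex) (auto simp: inj_on_def)
  finally have o: "(\<Sum>f\<in>R. \<Phi> (fst f) (snd f) * of_bool (fst f = t)) = (\<Sum>u\<in>?O. \<Phi> t u)" .
  have "nbrs t = ?O \<union> ?I" "?O \<inter> ?I = {}" using R_orient[of _ t] by blast+
  then have "(\<Sum>u\<in>nbrs t. \<Phi> t u) = (\<Sum>u\<in>?O. \<Phi> t u) + (\<Sum>u\<in>?I. \<Phi> t u)"
    using sum.union_disjoint[of ?O ?I "\<Phi> t"] by simp
  with i o show ?thesis by (simp add: right_diff_distrib sum_subtractf)
qed

lemma prox_minimizer_exists: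
  assumes \<mu>: "0 < \<mu>" and x: "x \<in> log_scales n d"
  shows "\<exists>y\<in>log_scales n d. \<forall>z\<in>log_scales n d.
     prox_objective n d R score \<mu> \<sigma> x y \<le> prox_objective n d R score \<mu> \<sigma> x z"
proof -
  let ?f = "prox_objective n d R score \<mu> \<sigma> x"
  \<comment> \<open>Large enough that the proximal term alone beats the value at \<open>x\<close>
    once a coordinate moves by more than \<open>M\<close>; the summand 1 ensures
    \<open>M <= M^2\<close>.\<close>
  define M where "M = 2 / \<mu> * ?f x + 1"
  \<comment> \<open>Outside \<open>T\<close> an extensional function takes the value
    \<open>undefined\<close>, so the factor there is a singleton and the box is compact over the
    infinite index type.\<close>
  define S where "S t = (if t \<in> T then {x t - M..x t + M} else {undefined})" for t
  define K where "K = PiE UNIV S"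
  have quad: "0 \<le> 1/2 * (\<Sum>f\<in>R. base_weight score f * cauchy_weight \<sigma> (residual d f x) * (residual d f z)\<^sup>2)" for z
    by (intro mult_nonneg_nonneg sum_nonneg) (auto simp: base_weight_nonneg less_imp_le[OF cauchy_weight_pos])
  have fx: "0 \<le> ?f x" using quad[of x] by (simp add: prox_objective_def)
  then have M: "1 \<le> M" using \<mu> by (simp add: M_def)
  have KL: "K \<subseteq> log_scales n d" by (auto simp: K_def S_def log_scales_def PiE_def Pi_def extensional_def)
  have "compactin (product_topology (\<lambda>_. euclidean) UNIV) K"
    unfolding K_def compactin_PiE by (auto simp: S_def)
  then have "compact K" by (simp add: euclidean_product_topology)
  moreover have "x \<in> K" using x M by (auto simp: K_def S_def log_scales_def PiE_def extensional_def)
  moreover have "continuous_on K ?f"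
    unfolding prox_objective_def residual_eq
    by (intro continuous_intros continuous_on_subset[OF continuous_on_product_coordinates subset_UNIV])
  ultimately obtain y where y: "y \<in> K" "\<And>z. z \<in> K \<Longrightarrow> ?f y \<le> ?f z"
    using continuous_attains_inf[of K ?f] by blast
  have "?f y \<le> ?f z" if z: "z \<in> log_scales n d" for z
  proof (cases "z \<in> K")
    case False
    have "\<exists>t\<in>T. \<bar>z t - x t\<bar> > M"
    proof (rule ccontr)
      assume near: "\<not> ?thesis"
      have "z t \<in> S t" for t
      proof (cases "t \<in> T")
        case True
        then have "\<bar>z t - x t\<bar> \<le> M" using near not_less by blast
        then show ?thesis using True by (simp add: S_def abs_le_iff)
      next
        case False
        then show ?thesis using z PiE_arb[of z T "\<lambda>_. UNIV" t] by (simp add: S_def log_scales_def)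
      qed
      then have "z \<in> K" unfolding K_def by (simp add: PiE_iff)
      with False show False ..
    qed
    then obtain t where t: "t \<in> T" "\<bar>z t - x t\<bar> > M" by blast
    have "?f x < \<mu> / 2 * M" using \<mu> by (simp add: M_def field_simps)
    also have "\<dots> \<le> \<mu> / 2 * (z t - x t)\<^sup>2"
    proof -
      have "M \<le> M\<^sup>2" using M by (simp add: power2_eq_square)
      also have "\<dots> \<le> \<bar>z t - x t\<bar>\<^sup>2" using t M by (intro power_mono) auto
      finally show ?thesis using \<mu> by simp
    qed
    also have "\<dots> \<le> \<mu> / 2 * (\<Sum>t\<in>T. (z t - x t)\<^sup>2)"
      using \<mu> member_le_sum[of t T "\<lambda>t. (z t - x t)\<^sup>2"] t by (intro mult_left_mono) auto
    also have "\<dots> \<le> ?f z" using quad[of z] by (simp add: prox_objective_def)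
    finally show ?thesis using y(2)[OF \<open>x \<in> K\<close>] by simp
  qed (use y in auto)
  then show ?thesis using y(1) KL by blast
qed

lemma prox_irls_map_minimizes:
  assumes "0 < \<mu>" "x \<in> log_scales n d"
  shows "prox_irls_map n d R score \<mu> \<sigma> x \<in> log_scales n d"
    "z \<in> log_scales n d \<Longrightarrow> prox_objective n d R score \<mu> \<sigma> x (prox_irls_map n d R score \<mu> \<sigma> x)
       \<le> prox_objective n d R score \<mu> \<sigma> x z"
proof -
  let ?P = "is_arg_min (prox_objective n d R score \<mu> \<sigma> x) (\<lambda>y. y \<in> log_scales n d)"
  have "\<exists>y. ?P y" using prox_minimizer_exists[OF assms] by (fastforce simp: is_arg_min_linorder)
  then have "?P (prox_irls_map n d R score \<mu> \<sigma> x)"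
    unfolding prox_irls_map_def arg_min_on_def arg_min_def by (rule someI_ex)
  then show "prox_irls_map n d R score \<mu> \<sigma> x \<in> log_scales n d"
    "z \<in> log_scales n d \<Longrightarrow> prox_objective n d R score \<mu> \<sigma> x (prox_irls_map n d R score \<mu> \<sigma> x)
       \<le> prox_objective n d R score \<mu> \<sigma> x z"
    by (auto simp: is_arg_min_linorder)
qed

text \<open>First-order condition without derivatives: moving coordinate \<open>t\<close> by
  \<open>s\<close> changes the objective by a quadratic in \<open>s\<close> without constant term.
  It is never negative, so its linear coefficient vanishes.\<close>

lemma prox_irls_stationary:
  assumes \<mu>: "0 < \<mu>" and x: "x \<in> log_scales n d" and y: "y = prox_irls_map n d R score \<mu> \<sigma> x" and t: "t \<in> T"
  shows "\<mu> * (y t - x t) = (\<Sum>u\<in>nbrs t. wt t u * cauchy_weight \<sigma> (res t u x) * res t u y)"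
proof -
  let ?f = "prox_objective n d R score \<mu> \<sigma> x"
  define W where "W f = base_weight score f * cauchy_weight \<sigma> (residual d f x)" for f
  define c where "c f = (of_bool (snd f = t) - of_bool (fst f = t) :: real)" for f :: "triple \<times> triple"
  have yL: "y \<in> log_scales n d" unfolding y by (rule prox_irls_map_minimizes(1)[OF \<mu> x])
  have "(\<Sum>f\<in>R. W f * residual d f y * c f) + \<mu> * (y t - x t) = 0"
  proof (rule linear_coeff_zero_if_quadratic_nonneg)
    fix s
    define z where "z = y(t := y t + s)"
    have "z \<in> log_scales n d" using yL t by (auto simp: z_def log_scales_def PiE_def extensional_def)
    then have "?f y \<le> ?f z" unfolding y by (rule prox_irls_map_minimizes(2)[OF \<mu> x])
    have r: "residual d f z = residual d f y + s * c f" for f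
      by (auto simp: residual_eq z_def c_def)
    have sq: "(\<Sum>f\<in>R. W f * (residual d f z)\<^sup>2)
        = (\<Sum>f\<in>R. W f * (residual d f y)\<^sup>2) + 2 * s * (\<Sum>f\<in>R. W f * residual d f y * c f) + s\<^sup>2 * (\<Sum>f\<in>R. W f * (c f)\<^sup>2)"
      unfolding r sum_distrib_left sum.distrib[symmetric]
      by (rule sum.cong) (simp_all add: power2_eq_square algebra_simps)
    have sq': "(\<Sum>u\<in>T. (z u - x u)\<^sup>2) = (\<Sum>u\<in>T. (y u - x u)\<^sup>2) + 2 * s * (y t - x t) + s\<^sup>2"
    proof -
      have "(\<Sum>u\<in>T. (z u - x u)\<^sup>2) = (z t - x t)\<^sup>2 + (\<Sum>u\<in>T - {t}. (z u - x u)\<^sup>2)"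
        using t by (simp add: sum.remove)
      also have "(\<Sum>u\<in>T - {t}. (z u - x u)\<^sup>2) = (\<Sum>u\<in>T - {t}. (y u - x u)\<^sup>2)"
        by (rule sum.cong) (auto simp: z_def)
      also have "\<dots> = (\<Sum>u\<in>T. (y u - x u)\<^sup>2) - (y t - x t)\<^sup>2"
        using t by (simp add: sum.remove)
      finally show ?thesis by (simp add: z_def power2_eq_square algebra_simps)
    qed
    have "?f z = ?f y + s * ((\<Sum>f\<in>R. W f * residual d f y * c f) + \<mu> * (y t - x t))
        + s\<^sup>2 * (1/2 * (\<Sum>f\<in>R. W f * (c f)\<^sup>2) + \<mu> / 2)"
      unfolding prox_objective_def W_def[symmetric] sq sq' by (simp add: field_simps)
    with \<open>?f y \<le> ?f z\<close> show "0 \<le> s * ((\<Sum>f\<in>R. W f * residual d f y * c f) + \<mu> * (y t - x t))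
        + s\<^sup>2 * (1/2 * (\<Sum>f\<in>R. W f * (c f)\<^sup>2) + \<mu> / 2)" by linarith
  qed
  moreover have "(\<Sum>f\<in>R. W f * residual d f y * c f) = - (\<Sum>u\<in>nbrs t. wt t u * cauchy_weight \<sigma> (res t u x) * res t u y)"
  proof -
    have "(\<Sum>f\<in>R. W f * residual d f y * c f) = (\<Sum>f\<in>R. wt (fst f) (snd f) * cauchy_weight \<sigma> (res (fst f) (snd f) x)
        * res (fst f) (snd f) y * (of_bool (snd f = t) - of_bool (fst f = t)))"
      by (simp only: W_def c_def wt_def res_def prod.collapse)
    also have "\<dots> = - (\<Sum>u\<in>nbrs t. wt t u * cauchy_weight \<sigma> (res t u x) * res t u y)"
    proof (rule rows_sum_at)
      fix t u assume "u \<in> nbrs t"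
      then show "wt u t * cauchy_weight \<sigma> (res u t x) * res u t y = - (wt t u * cauchy_weight \<sigma> (res t u x) * res t u y)"
        using res_antisym[of u t x] res_antisym[of u t y] wt_sym[of u t] by simp
    qed
    finally show ?thesis .
  qed
  ultimately show ?thesis by linarith
qed

section \<open>Descent, step lengths and approximate stationarity\<close>

definition total_loss :: "real \<Rightarrow> (triple \<Rightarrow> real) \<Rightarrow> real" where
  "total_loss \<sigma> z = (\<Sum>f\<in>R. base_weight score f * cauchy_loss \<sigma> (residual d f z))"

lemma total_loss_nonneg: "0 \<le> total_loss \<sigma> z"
  unfolding total_loss_def by (intro sum_nonneg mult_nonneg_nonneg base_weight_nonneg cauchy_loss_nonneg)

text \<open>Majorize-minimize: up to a constant, the reweighted quadratic is an upper bound for the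
  loss that touches it at \<open>x\<close>, so the decrease of the proximal objective carries
  over.\<close>

lemma prox_irls_descent:
  assumes \<mu>: "0 < \<mu>" and \<sigma>: "0 < \<sigma>" and x: "x \<in> log_scales n d" and y: "y = prox_irls_map n d R score \<mu> \<sigma> x"
  shows "total_loss \<sigma> y + \<mu> / 2 * (\<Sum>t\<in>T. (y t - x t)\<^sup>2) \<le> total_loss \<sigma> x"
proof -
  let ?Q = "\<lambda>z. \<Sum>f\<in>R. base_weight score f * cauchy_weight \<sigma> (residual d f x) * (residual d f z)\<^sup>2"
  have "prox_objective n d R score \<mu> \<sigma> x y \<le> prox_objective n d R score \<mu> \<sigma> x x"
    unfolding y by (rule prox_irls_map_minimizes(2)[OF \<mu> x x])
  then have "1/2 * ?Q y + \<mu> / 2 * (\<Sum>t\<in>T. (y t - x t)\<^sup>2) \<le> 1/2 * ?Q x"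
    by (simp add: prox_objective_def)
  moreover have "total_loss \<sigma> y - total_loss \<sigma> x \<le> 1/2 * ?Q y - 1/2 * ?Q x"
  proof -
    have "total_loss \<sigma> y - total_loss \<sigma> x
        = (\<Sum>f\<in>R. base_weight score f * (cauchy_loss \<sigma> (residual d f y) - cauchy_loss \<sigma> (residual d f x)))"
      by (simp add: total_loss_def sum_subtractf right_diff_distrib)
    also have "\<dots> \<le> (\<Sum>f\<in>R. base_weight score f *
        (1/2 * cauchy_weight \<sigma> (residual d f x) * ((residual d f y)\<^sup>2 - (residual d f x)\<^sup>2)))"
      by (intro sum_mono mult_left_mono cauchy_loss_majorized[OF \<sigma>] base_weight_nonneg)
    also have "\<dots> = 1/2 * ?Q y - 1/2 * ?Q x"
      unfolding sum_distrib_left sum_subtractf[symmetric]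
      by (rule sum.cong) (simp_all add: algebra_simps)
    finally show ?thesis .
  qed
  ultimately show ?thesis by linarith
qed

lemma nbr_weight:
  assumes "u \<in> nbrs t"
  shows "0 \<le> wt t u * cauchy_weight \<sigma> r" "wt t u * cauchy_weight \<sigma> r \<le> cauchy_weight \<sigma> r"
    "wt t u * cauchy_weight \<sigma> r \<le> 1"
proof -
  have w: "0 \<le> wt t u" "wt t u \<le> 1" using assms wt_bounds nbrs_iff by auto
  note c = less_imp_le[OF cauchy_weight_pos[of \<sigma> r]] cauchy_weight_le_1[of \<sigma> r]
  show "0 \<le> wt t u * cauchy_weight \<sigma> r" using w c by simp
  show le: "wt t u * cauchy_weight \<sigma> r \<le> cauchy_weight \<sigma> r" using w c by (simp add: mult_left_le_one_le)
  show "wt t u * cauchy_weight \<sigma> r \<le> 1" using le c by linarith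
qed

lemma influence_le:
  assumes "u \<in> nbrs t" "0 < \<sigma>"
  shows "wt t u * cauchy_weight \<sigma> r * \<bar>r\<bar> \<le> \<sigma> / 2"
  using mult_right_mono[OF nbr_weight(2)[OF assms(1), of \<sigma> r], of "\<bar>r\<bar>"] cauchy_influence_le[OF assms(2), of r]
  by simp

lemma real_card_nbrs: "t \<in> T \<Longrightarrow> real (card (nbrs t)) \<le> 3 * real n"
  using card_nbrs by (metis of_nat_le_iff of_nat_mult of_nat_numeral)

text \<open>Maximum principle on all retained triangles, corrupted ones included. Where the signed
  displacement is largest, no neighbour moves further, so the new signed residual is at most the old
  absolute one. At most \<open>3 * n\<close> influences of size \<open>\<sigma> / 2\<close> against
  the damping \<open>n / 28\<close> give 3/2 * 28 = 42.\<close>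

lemma prox_step_bound:
  assumes n: "0 < n" and \<sigma>: "0 < \<sigma>" and x: "x \<in> log_scales n d"
    and y: "y = prox_irls_map n d R score (1 / 28 * real n) \<sigma> x"
    and t: "t \<in> T"
  shows "\<bar>y t - x t\<bar> \<le> 42 * \<sigma>"
proof -
  have \<mu>: "0 < 1 / 28 * real n" using n by simp
  have main: "e * (y t - x t) \<le> 42 * \<sigma>"
    if e: "e = 1 \<or> e = - 1" and t: "t \<in> T" and mx: "\<And>u. u \<in> T \<Longrightarrow> e * (y u - x u) \<le> e * (y t - x t)" for e t
  proof -
    define D where "D = e * (y t - x t)"
    have "1 / 28 * real n * D = e * (1 / 28 * real n * (y t - x t))" by (simp add: D_def)
    also have "\<dots> = (\<Sum>u\<in>nbrs t. wt t u * cauchy_weight \<sigma> (res t u x) * (e * res t u y))"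
      unfolding prox_irls_stationary[OF \<mu> x y t] by (simp add: sum_distrib_left algebra_simps)
    also have "\<dots> \<le> (\<Sum>u\<in>nbrs t. \<sigma> / 2)"
    proof (rule sum_mono)
      fix u assume u: "u \<in> nbrs t"
      have "e * res t u y = e * res t u x + (e * (y u - x u) - e * (y t - x t))"
        by (simp add: res_diff[of t u y x] algebra_simps)
      also have "\<dots> \<le> \<bar>res t u x\<bar>"
      proof -
        have "e * (y u - x u) \<le> e * (y t - x t)" using mx[of u] u nbrs_subset_T by blast
        moreover have "e * res t u x \<le> \<bar>res t u x\<bar>" using e by (elim disjE) simp_all
        ultimately show ?thesis by linarith
      qed
      finally have "wt t u * cauchy_weight \<sigma> (res t u x) * (e * res t u y)
          \<le> wt t u * cauchy_weight \<sigma> (res t u x) * \<bar>res t u x\<bar>"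
        by (rule mult_left_mono) (rule nbr_weight(1)[OF u])
      also have "\<dots> \<le> \<sigma> / 2" by (rule influence_le[OF u \<sigma>])
      finally show "wt t u * cauchy_weight \<sigma> (res t u x) * (e * res t u y) \<le> \<sigma> / 2" .
    qed
    also have "\<dots> \<le> 3 * real n * (\<sigma> / 2)"
      using real_card_nbrs[OF t] \<sigma> by (simp add: mult_right_mono)
    finally have "1 / 28 * real n * D \<le> 3 * real n * (\<sigma> / 2)" .
    then have "real n * D \<le> real n * (42 * \<sigma>)" by (simp add: mult_ac)
    then show ?thesis using n by (simp add: D_def)
  qed
  have ext: "\<exists>w\<in>T. \<forall>u\<in>T. g u \<le> g w" for g :: "triple \<Rightarrow> real"
  proof -
    have "Max (g ` T) \<in> g ` T" using t by (intro Max_in) auto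
    then obtain w where "w \<in> T" "g w = Max (g ` T)" by (metis imageE)
    then show ?thesis by (intro bexI[of _ w]) auto
  qed
  obtain w where w: "w \<in> T" "\<And>u. u \<in> T \<Longrightarrow> 1 * (y u - x u) \<le> 1 * (y w - x w)"
    using ext[of "\<lambda>u. 1 * (y u - x u)"] by blast
  obtain w' where w': "w' \<in> T" "\<And>u. u \<in> T \<Longrightarrow> - 1 * (y u - x u) \<le> - 1 * (y w' - x w')"
    using ext[of "\<lambda>u. - 1 * (y u - x u)"] by blast
  have "1 * (y w - x w) \<le> 42 * \<sigma>" by (rule main) (use w in auto)
  moreover have "- 1 * (y w' - x w') \<le> 42 * \<sigma>" by (rule main) (use w' in auto)
  ultimately show ?thesis using w(2)[OF t] w'(2)[OF t] by (simp add: abs_le_iff)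
qed

text \<open>A coordinate of the negative gradient of \<open>total_loss\<close>.\<close>

definition influence_sum :: "real \<Rightarrow> triple \<Rightarrow> (triple \<Rightarrow> real) \<Rightarrow> real" where
  "influence_sum \<sigma> t z = (\<Sum>u\<in>nbrs t. wt t u * cauchy_weight \<sigma> (res t u z) * res t u z)"

lemma continuous_influence_sum: "continuous_on UNIV (influence_sum \<sigma> t)"
proof -
  have nz: "1 + (r / \<sigma>)\<^sup>2 \<noteq> 0" for r by (metis add_pos_nonneg less_irrefl zero_le_power2 zero_less_one)
  show ?thesis
    unfolding influence_sum_def cauchy_weight_def res_def residual.simps times_divide_eq_right divide_inverse mult_1_right
    by (intro continuous_intros continuous_on_product_coordinates) (use nz in \<open>simp add: divide_inverse\<close>)
qed

text \<open>The stationarity equation mixes weights at \<open>x\<close> with residuals at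
  \<open>y\<close>. Rewriting it at \<open>x\<close> alone leaves an error linear in the step, so a
  short step means a small gradient.\<close>

lemma influence_sum_le_step:
  assumes \<mu>: "0 < \<mu>" and x: "x \<in> log_scales n d" and y: "y = prox_irls_map n d R score \<mu> \<sigma> x" and t: "t \<in> T"
  shows "\<bar>influence_sum \<sigma> t x\<bar> \<le> \<mu> * \<bar>y t - x t\<bar> + (\<Sum>u\<in>nbrs t. \<bar>y u - x u\<bar> + \<bar>y t - x t\<bar>)"
proof -
  let ?w = "\<lambda>u. wt t u * cauchy_weight \<sigma> (res t u x)"
  have "influence_sum \<sigma> t x = \<mu> * (y t - x t) - (\<Sum>u\<in>nbrs t. ?w u * ((y u - x u) - (y t - x t)))"
    unfolding influence_sum_def prox_irls_stationary[OF assms]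
    by (simp add: sum_subtractf[symmetric] res_diff[of t _ y x] algebra_simps)
  moreover have "\<bar>\<Sum>u\<in>nbrs t. ?w u * ((y u - x u) - (y t - x t))\<bar> \<le> (\<Sum>u\<in>nbrs t. \<bar>y u - x u\<bar> + \<bar>y t - x t\<bar>)"
  proof (rule order_trans[OF sum_abs sum_mono])
    fix u assume u: "u \<in> nbrs t"
    have "\<bar>?w u * ((y u - x u) - (y t - x t))\<bar> = ?w u * \<bar>(y u - x u) - (y t - x t)\<bar>"
      unfolding abs_mult[of "?w u"] abs_of_nonneg[OF nbr_weight(1)[OF u]] ..
    also have "\<dots> \<le> 1 * \<bar>(y u - x u) - (y t - x t)\<bar>"
      by (rule mult_right_mono[OF nbr_weight(3)[OF u]]) simp
    also have "\<dots> \<le> \<bar>y u - x u\<bar> + \<bar>y t - x t\<bar>" by simp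
    finally show "\<bar>?w u * ((y u - x u) - (y t - x t))\<bar> \<le> \<bar>y u - x u\<bar> + \<bar>y t - x t\<bar>" .
  qed
  moreover have "\<bar>\<mu> * (y t - x t)\<bar> = \<mu> * \<bar>y t - x t\<bar>" using \<mu> by (simp add: abs_mult)
  ultimately show ?thesis by linarith
qed

text \<open>The loss decreases and is bounded below, so its decrements tend to zero, and each of
  them dominates the squared step.\<close>

lemma prox_orbit_steps_vanish:
  assumes \<mu>: "0 < \<mu>" and \<sigma>: "0 < \<sigma>" and X: "\<And>m. X m \<in> log_scales n d"
    and step: "\<And>m. X (Suc m) = prox_irls_map n d R score \<mu> \<sigma> (X m)" and t: "t \<in> T"
  shows "(\<lambda>m. \<bar>X (Suc m) t - X m t\<bar>) \<longlonglongrightarrow> 0"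
proof -
  let ?F = "\<lambda>m. total_loss \<sigma> (X m)"
  have le: "?F (Suc m) + \<mu> / 2 * (X (Suc m) t - X m t)\<^sup>2 \<le> ?F m" for m
  proof -
    have "\<mu> / 2 * (X (Suc m) t - X m t)\<^sup>2 \<le> \<mu> / 2 * (\<Sum>t\<in>T. (X (Suc m) t - X m t)\<^sup>2)"
      using \<mu> member_le_sum[of t T "\<lambda>t. (X (Suc m) t - X m t)\<^sup>2"] t by (intro mult_left_mono) auto
    then show ?thesis using prox_irls_descent[OF \<mu> \<sigma> X step[of m]] by linarith
  qed
  have "decseq ?F"
  proof (rule decseq_SucI)
    fix m
    have "0 \<le> \<mu> / 2 * (X (Suc m) t - X m t)\<^sup>2" using \<mu> by simp
    with le[of m] show "?F (Suc m) \<le> ?F m" by linarith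
  qed
  then obtain L where L: "?F \<longlonglongrightarrow> L"
    using decseq_convergent[of ?F 0] total_loss_nonneg by blast
  have "(\<lambda>m. 2 / \<mu> * (?F m - ?F (Suc m))) \<longlonglongrightarrow> 2 / \<mu> * (L - L)"
    by (intro tendsto_intros L LIMSEQ_Suc)
  then have lim: "(\<lambda>m. 2 / \<mu> * (?F m - ?F (Suc m))) \<longlonglongrightarrow> 0" by simp
  have "(\<lambda>m. (X (Suc m) t - X m t)\<^sup>2) \<longlonglongrightarrow> 0"
  proof (rule tendsto_sandwich[OF _ _ tendsto_const lim])
    show "\<forall>\<^sub>F m in sequentially. (X (Suc m) t - X m t)\<^sup>2 \<le> 2 / \<mu> * (?F m - ?F (Suc m))"
      using le \<mu> by (intro always_eventually allI) (simp add: field_simps)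
  qed simp
  then have "(\<lambda>m. sqrt ((X (Suc m) t - X m t)\<^sup>2)) \<longlonglongrightarrow> sqrt 0" by (rule tendsto_real_sqrt)
  then show ?thesis by simp
qed

end

section \<open>Cluster points and the graduated scheme\<close>

lemma cluster_point_le:
  fixes h :: "'a::topological_space \<Rightarrow> real"
  assumes "cluster_point X z" "continuous_on UNIV h" "\<And>m. h (X m) \<le> c"
  shows "h z \<le> c"
proof (rule ccontr)
  assume "\<not> h z \<le> c"
  then have "z \<in> {x. c < h x}" by simp
  moreover have "open {x. c < h x}" by (rule open_Collect_less[OF continuous_on_const assms(2)])
  ultimately have "\<exists>\<^sub>F m in sequentially. X m \<in> {x. c < h x}"
    using assms(1) unfolding cluster_point_def by blast
  then obtain m where "c < h (X m)" by (auto dest: frequently_ex)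
  then show False using assms(3)[of m] by simp
qed

text \<open>A nonzero value would be felt on a neighbourhood that the orbit visits infinitely often
  but eventually leaves for good. No convergence of the orbit itself is required.\<close>

lemma cluster_point_tendsto_0:
  fixes g :: "'a::topological_space \<Rightarrow> real"
  assumes "cluster_point X z" "continuous_on UNIV g" "(\<lambda>m. g (X m)) \<longlonglongrightarrow> 0"
  shows "g z = 0"
proof (rule ccontr)
  assume "g z \<noteq> 0"
  define e where "e = \<bar>g z\<bar> / 2"
  have e: "0 < e" "e < \<bar>g z\<bar>" using \<open>g z \<noteq> 0\<close> by (auto simp: e_def)
  have "open {x. e < \<bar>g x\<bar>}" by (intro open_Collect_less continuous_intros assms(2))
  then have "\<exists>\<^sub>F m in sequentially. X m \<in> {x. e < \<bar>g x\<bar>}"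
    using assms(1) e(2) unfolding cluster_point_def by blast
  moreover have "\<forall>\<^sub>F m in sequentially. \<bar>g (X m)\<bar> < e"
    using assms(3) e(1) by (auto simp: tendsto_iff)
  then have "\<forall>\<^sub>F m in sequentially. X m \<notin> {x. e < \<bar>g x\<bar>}" by (rule eventually_mono) simp
  ultimately show False by (simp add: frequently_def)
qed

context large_camera_rows
begin

lemma sum_nbrs_split:
  fixes f :: "triple \<Rightarrow> real"
  shows "(\<Sum>v\<in>nbrs u. f v) = (\<Sum>v\<in>nbrs u \<inter> V. f v) + (\<Sum>v\<in>nbrs u - V. f v)"
  by (rule sum.Int_Diff) simp

lemma bad_nbrs_sum_le:
  assumes u: "u \<in> V" and f: "\<And>v. v \<in> nbrs u \<Longrightarrow> \<bar>f v\<bar> \<le> M" and M: "0 \<le> (M :: real)"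
  shows "\<bar>\<Sum>v\<in>nbrs u - V. f v\<bar> \<le> 6 * \<Delta> * M"
proof -
  have "\<bar>\<Sum>v\<in>nbrs u - V. f v\<bar> \<le> (\<Sum>v\<in>nbrs u - V. M)"
    using f by (intro order_trans[OF sum_abs] sum_mono) auto
  also have "\<dots> = real (card (nbrs u - V)) * M" by simp
  also have "\<dots> \<le> real (6 * max_degree n Eb) * M"
    using card_bad_nbrs[OF u] M by (intro mult_right_mono) (simp_all only: of_nat_le_iff)
  finally show ?thesis by simp
qed

lemma clean_weight:
  assumes "0 < \<sigma>" "\<And>u v. u \<in> V \<Longrightarrow> v \<in> V \<Longrightarrow> err x u - err x v \<le> \<sigma> / 10"
    and "u \<in> V" "v \<in> nbrs u \<inter> V"
  shows "100/101 \<le> cauchy_weight \<sigma> (res u v x) \<and> cauchy_weight \<sigma> (res u v x) \<le> 1"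
proof -
  have "res u v x = err x v - err x u" using res_clean assms(3,4) by blast
  then have "\<bar>res u v x\<bar> \<le> \<sigma> / 10"
    using assms(2)[of u v] assms(2)[of v u] assms(3,4) unfolding abs_le_iff by simp
  then show ?thesis using cauchy_weight_ge[OF assms(1)] cauchy_weight_le_1 by blast
qed

lemma prox_preserves_clean_oscillation:
  assumes \<sigma>: "0 < \<sigma>" and x: "x \<in> log_scales n d"
    and y: "y = prox_irls_map n d R score (1 / 28 * real n) \<sigma> x"
    and osc: "\<And>u v. u \<in> V \<Longrightarrow> v \<in> V \<Longrightarrow> err x u - err x v \<le> \<sigma> / 10"
    and tw: "t \<in> V" "w \<in> V"
  shows "err y t - err y w \<le> \<sigma> / 10"
proof -
  let ?w = "\<lambda>u v. cauchy_weight \<sigma> (res u v x)"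
  let ?b = "\<lambda>u. \<Sum>v\<in>nbrs u - V. wt u v * ?w u v * res u v y"
  have n: "0 < n" and \<mu>: "0 < 1 / 28 * real n" using n_large by simp_all
  show ?thesis
  proof (rule prox_oscillation[where om = ?w and b = ?b and B = "507 * \<Delta> * \<sigma>" and \<mu> = "1 / 28 * real n" and x = "err x"])
    show "100/101 \<le> ?w u v \<and> ?w u v \<le> 1" if "u \<in> V" "v \<in> nbrs u \<inter> V" for u v
      by (rule clean_weight[OF \<sigma> osc that])
    show "\<bar>?b u\<bar> \<le> 507 * \<Delta> * \<sigma>" if u: "u \<in> V" for u
    proof -
      \<comment> \<open>The old residual contributes its influence; the change of the residual
        involves two displacements of at most \<open>42 * \<sigma>\<close> each.\<close>
      have "\<bar>?b u\<bar> \<le> 6 * \<Delta> * (\<sigma> / 2 + 84 * \<sigma>)"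
      proof (rule bad_nbrs_sum_le[OF u])
        fix v assume v: "v \<in> nbrs u"
        let ?c = "wt u v * ?w u v"
        have c: "0 \<le> ?c" "?c \<le> 1" using nbr_weight[OF v] by blast+
        have "u \<in> T" "v \<in> T" using u v V_subset_T nbrs_subset_T by blast+
        then have "\<bar>y u - x u\<bar> \<le> 42 * \<sigma>" "\<bar>y v - x v\<bar> \<le> 42 * \<sigma>"
          using prox_step_bound[OF n \<sigma> x y] by blast+
        then have "\<bar>res u v y\<bar> \<le> \<bar>res u v x\<bar> + 84 * \<sigma>"
          using res_diff[of u v y x] by linarith
        then have "?c * \<bar>res u v y\<bar> \<le> ?c * (\<bar>res u v x\<bar> + 84 * \<sigma>)"
          using c(1) by (rule mult_left_mono)
        also have "\<dots> \<le> \<sigma> / 2 + 1 * (84 * \<sigma>)"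
          using influence_le[OF v \<sigma>, of "res u v x"] c(2) \<sigma>
          unfolding distrib_left by (intro add_mono mult_right_mono) auto
        finally show "\<bar>?c * res u v y\<bar> \<le> \<sigma> / 2 + 84 * \<sigma>"
          unfolding abs_mult[of ?c] abs_of_nonneg[OF c(1)] by simp
      qed (use \<sigma> in simp)
      then show ?thesis by (simp add: algebra_simps)
    qed
    show "1 / 28 * real n * (err y u - err x u)
        = (\<Sum>v\<in>nbrs u \<inter> V. ?w u v * (err y v - err y u)) + ?b u" if u: "u \<in> V" for u
    proof -
      have "u \<in> T" using u V_subset_T by blast
      have "(\<Sum>v\<in>nbrs u \<inter> V. wt u v * ?w u v * res u v y) = (\<Sum>v\<in>nbrs u \<inter> V. ?w u v * (err y v - err y u))"
        by (rule sum.cong) (use u in \<open>auto simp: wt_clean res_clean\<close>)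
      then show ?thesis
        using prox_irls_stationary[OF \<mu> x y \<open>u \<in> T\<close>] sum_nbrs_split[of "\<lambda>v. wt u v * ?w u v * res u v y" u]
        by (simp add: err_def)
    qed
    \<comment> \<open>13.1 * 507 is below 6642, while the degree bound allows 10000. Among the
      numerical conditions on \<Delta>, this one leaves the least room.\<close>
    show "13.1 * (507 * \<Delta> * \<sigma>) \<le> \<sigma> / 10 * real n"
    proof -
      have "(13.1 * 507 * \<Delta>) * \<sigma> \<le> (1/10 * real n) * \<sigma>"
        using degree_small \<sigma> by (intro mult_right_mono) auto
      then show ?thesis by (simp add: algebra_simps)
    qed
  qed (use \<mu> osc tw in auto)
qed

lemma cluster_point_clean_oscillation:
  assumes \<sigma>: "0 < \<sigma>" and x: "x \<in> log_scales n d"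
    and osc: "\<And>u v. u \<in> V \<Longrightarrow> v \<in> V \<Longrightarrow> err x u - err x v \<le> \<sigma> / 10"
    and cl: "cluster_point (\<lambda>m. (prox_irls_map n d R score (1 / 28 * real n) \<sigma> ^^ m) x) z"
    and tw: "t \<in> V" "w \<in> V"
  shows "(err z t - err z w) * real n \<le> 26.1 * \<Delta> * \<sigma>"
proof -
  define X where "X m = (prox_irls_map n d R score (1 / 28 * real n) \<sigma> ^^ m) x" for m
  have step: "X (Suc m) = prox_irls_map n d R score (1 / 28 * real n) \<sigma> (X m)" for m
    by (simp add: X_def)
  have \<mu>: "0 < 1 / 28 * real n" using n_large by simp
  have XL: "X m \<in> log_scales n d" for m
  proof (induction m)
    case (Suc m)
    then show ?case unfolding step by (rule prox_irls_map_minimizes(1)[OF \<mu>])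
  qed (simp add: X_def x)
  have X_osc: "\<forall>u\<in>V. \<forall>v\<in>V. err (X m) u - err (X m) v \<le> \<sigma> / 10" for m
  proof (induction m)
    case (Suc m)
    then show ?case using prox_preserves_clean_oscillation[OF \<sigma> XL step[of m]] by blast
  qed (use osc in \<open>simp add: X_def\<close>)
  have cl: "cluster_point X z" using cl by (simp add: X_def[abs_def])
  have z_osc: "err z u - err z v \<le> \<sigma> / 10" if "u \<in> V" "v \<in> V" for u v
  proof (rule cluster_point_le[OF cl, where h = "\<lambda>z. err z u - err z v"])
    show "continuous_on UNIV (\<lambda>z. err z u - err z v)"
      unfolding err_def by (intro continuous_intros continuous_on_product_coordinates)
  qed (use X_osc that in blast)
  have stat: "influence_sum \<sigma> u z = 0" if u: "u \<in> T" for u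
  proof (rule cluster_point_tendsto_0[OF cl continuous_influence_sum])
    let ?D = "\<lambda>v m. \<bar>X (Suc m) v - X m v\<bar>"
    have D: "?D v \<longlonglongrightarrow> 0" if "v \<in> T" for v
      by (rule prox_orbit_steps_vanish[where X = X, OF \<mu> \<sigma> XL step that])
    have "(\<lambda>m. 1 / 28 * real n * ?D u m + (\<Sum>v\<in>nbrs u. ?D v m + ?D u m)) \<longlonglongrightarrow> 1 / 28 * real n * 0 + (\<Sum>v\<in>nbrs u. 0 + 0)"
    proof (intro tendsto_intros)
      show "?D v \<longlonglongrightarrow> 0" if "v \<in> nbrs u" for v using D that nbrs_subset_T by blast
    qed (rule D[OF u])+
    then have "(\<lambda>m. 1 / 28 * real n * ?D u m + (\<Sum>v\<in>nbrs u. ?D v m + ?D u m)) \<longlonglongrightarrow> 0" by simp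
    then show "(\<lambda>m. influence_sum \<sigma> u (X m)) \<longlonglongrightarrow> 0"
      by (rule Lim_null_comparison[rotated])
        (use influence_sum_le_step[OF \<mu> XL step u] in \<open>auto intro: always_eventually\<close>)
  qed
  let ?w = "\<lambda>u v. cauchy_weight \<sigma> (res u v z)"
  let ?b = "\<lambda>u. \<Sum>v\<in>nbrs u - V. wt u v * ?w u v * res u v z"
  \<comment> \<open>At a stationary point weights and residuals belong to the same \<open>z\<close>,
    so only the influence remains: \<open>6 * \<Delta> * (\<sigma> / 2)\<close>.\<close>
  have "(err z t - err z w) * real n \<le> 8.7 * (3 * \<Delta> * \<sigma>)"
  proof (rule stationary_oscillation[where om = ?w and b = ?b])
    show "100/101 \<le> ?w u v \<and> ?w u v \<le> 1" if "u \<in> V" "v \<in> nbrs u \<inter> V" for u v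
      by (rule clean_weight[OF \<sigma> z_osc that])
    show "\<bar>?b u\<bar> \<le> 3 * \<Delta> * \<sigma>" if u: "u \<in> V" for u
    proof -
      have "\<bar>?b u\<bar> \<le> 6 * \<Delta> * (\<sigma> / 2)"
      proof (rule bad_nbrs_sum_le[OF u])
        fix v assume v: "v \<in> nbrs u"
        show "\<bar>wt u v * ?w u v * res u v z\<bar> \<le> \<sigma> / 2"
          unfolding abs_mult[of "wt u v * ?w u v"] abs_of_nonneg[OF nbr_weight(1)[OF v]]
          by (rule influence_le[OF v \<sigma>])
      qed (use \<sigma> in simp)
      then show ?thesis by (simp add: mult_ac)
    qed
    show "(\<Sum>v\<in>nbrs u \<inter> V. ?w u v * (err z v - err z u)) + ?b u = 0" if u: "u \<in> V" for u
    proof -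
      have "u \<in> T" using u V_subset_T by blast
      have "(\<Sum>v\<in>nbrs u \<inter> V. wt u v * ?w u v * res u v z) = (\<Sum>v\<in>nbrs u \<inter> V. ?w u v * (err z v - err z u))"
        by (rule sum.cong) (use u in \<open>auto simp: wt_clean res_clean\<close>)
      then show ?thesis
        using stat[OF \<open>u \<in> T\<close>] sum_nbrs_split[of "\<lambda>v. wt u v * ?w u v * res u v z" u]
        by (simp add: influence_sum_def)
    qed
  qed (use tw in auto)
  then show ?thesis by simp
qed

text \<open>Rows between clean triangles have weight 1 and hence count in the maximum; six of them
  join any two clean triangles.\<close>

lemma max_ls_residual_clean_oscillation:
  assumes "t \<in> V" "w \<in> V"
  shows "\<bar>err z t - err z w\<bar> \<le> 6 * max_ls_residual d R score z"
proof (rule clean_path_bound[OF _ assms])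
  fix u v assume uv: "u \<in> V" "v \<in> nbrs u \<inter> V"
  let ?M = "{\<bar>residual d f z\<bar> | f. f \<in> R \<and> base_weight score f > 0}"
  have fin: "finite ?M" by (rule finite_subset[of _ "(\<lambda>f. \<bar>residual d f z\<bar>) ` R"]) (blast, simp)
  have "\<bar>res u v z\<bar> \<in> ?M"
  proof (cases "(u, v) \<in> R")
    case True
    moreover have "base_weight score (u, v) > 0" using wt_clean[of u v] uv by (simp add: wt_def)
    ultimately show ?thesis unfolding res_def by blast
  next
    case False
    then have "(v, u) \<in> R" using R_orient uv by blast
    moreover have "base_weight score (v, u) > 0" using wt_clean[of v u] uv by (simp add: wt_def)
    moreover have "\<bar>res u v z\<bar> = \<bar>residual d (v, u) z\<bar>"
      using res_antisym[of v u z] uv by (simp add: res_def del: residual.simps)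
    ultimately show ?thesis by blast
  qed
  then have "\<bar>res u v z\<bar> \<le> max_ls_residual d R score z"
    unfolding max_ls_residual_def by (rule Max_ge[OF fin])
  then show "\<bar>err z v - err z u\<bar> \<le> max_ls_residual d R score z"
    using res_clean[of u v z] uv by simp
qed

text \<open>The error at any one clean triangle serves as the gauge.\<close>

lemma gauge_error_le:
  assumes "\<And>t w. t \<in> V \<Longrightarrow> w \<in> V \<Longrightarrow> err z t - err z w \<le> r"
  shows "gauge_error n loc E0 d z \<le> r" "0 \<le> gauge_error n loc E0 d z"
proof -
  obtain w where w: "w \<in> V" using V_nonempty by blast
  let ?g = "\<lambda>\<alpha>. MAX t\<in>V. \<bar>z t - z_star loc d t - \<alpha>\<bar>"
  have nn: "0 \<le> ?g \<alpha>" for \<alpha>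
    by (rule order_trans[OF abs_ge_zero Max_ge[OF _ imageI[OF w]]]) simp
  have "gauge_error n loc E0 d z \<le> ?g (err z w)"
    unfolding gauge_error_def by (rule cINF_lower) (use nn in \<open>auto intro: bdd_belowI[of _ 0]\<close>)
  also have "\<dots> \<le> r"
  proof (rule Max.boundedI)
    fix a assume "a \<in> (\<lambda>t. \<bar>z t - z_star loc d t - err z w\<bar>) ` V"
    then obtain t where "t \<in> V" "a = \<bar>err z t - err z w\<bar>" by (auto simp: err_def)
    then show "a \<le> r" using assms[of t w] assms[of w t] w by (simp add: abs_le_iff)
  qed (use w in auto)
  finally show "gauge_error n loc E0 d z \<le> r" .
  show "0 \<le> gauge_error n loc E0 d z"
    unfolding gauge_error_def by (rule cINF_greatest) (use nn in auto)
qed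

lemma graduated_irls_error:
  assumes zLS: "zLS \<in> log_scales n d" and \<sigma>0: "0 < \<sigma> 0" "80 * max_ls_residual d R score zLS \<le> \<sigma> 0"
    and half: "\<And>k. \<sigma> (Suc k) = 1/2 * \<sigma> k"
    and z: "\<And>k. z k \<in> log_scales n d"
    and cl: "\<And>k. cluster_point
        (\<lambda>m. (prox_irls_map n d R score (1 / 28 * real n) (\<sigma> k) ^^ m) (case k of 0 \<Rightarrow> zLS | Suc j \<Rightarrow> z j)) (z k)"
  shows "gauge_error n loc E0 d (z k) \<le> 30 * \<Delta> * (\<sigma> k / real n)" "0 \<le> gauge_error n loc E0 d (z k)"
proof -
  let ?s = "\<lambda>k. case k of 0 \<Rightarrow> zLS | Suc j \<Rightarrow> z j"
  have \<sigma>: "0 < \<sigma> k" for k by (induction k) (simp_all add: \<sigma>0(1) half del: mult_eq_if)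
  have sL: "?s k \<in> log_scales n d" for k using zLS z by (cases k) auto
  have n: "0 < real n" using n_large by simp
  have zosc: "(err (z k) t - err (z k) w) * real n \<le> 26.1 * \<Delta> * \<sigma> k"
    if "\<And>u v. u \<in> V \<Longrightarrow> v \<in> V \<Longrightarrow> err (?s k) u - err (?s k) v \<le> \<sigma> k / 10" "t \<in> V" "w \<in> V" for k t w
    by (rule cluster_point_clean_oscillation[OF \<sigma> sL that(1) cl that(2,3)])
  have start: "\<forall>u\<in>V. \<forall>v\<in>V. err (?s k) u - err (?s k) v \<le> \<sigma> k / 10" for k
  proof (induction k)
    case 0
    show ?case
    proof (intro ballI)
      fix u v assume "u \<in> V" "v \<in> V"
      from max_ls_residual_clean_oscillation[OF this, of zLS]
      \<comment> \<open>Six residuals must fit into a tenth of the scale, which asks for a factor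
        60; the assumed 80 covers it.\<close>
      show "err (?s 0) u - err (?s 0) v \<le> \<sigma> 0 / 10" using \<sigma>0 by (simp add: abs_le_iff)
    qed
  next
    case (Suc k)
    show ?case
    proof (intro ballI)
      fix u v assume uv: "u \<in> V" "v \<in> V"
      have "(err (z k) u - err (z k) v) * real n \<le> 26.1 * \<Delta> * \<sigma> k"
        using zosc[of k u v] Suc uv by blast
      \<comment> \<open>\<open>\<sigma> k / 20\<close> is a tenth of the next scale, so halving
        \<sigma> restores exactly the hypothesis of the next stage.\<close>
      also have "\<dots> \<le> 1/20 * real n * \<sigma> k"
        using degree_small \<sigma>[of k] by (intro mult_right_mono) auto
      finally have "(err (z k) u - err (z k) v) * real n \<le> (1/20 * \<sigma> k) * real n" by (simp add: mult_ac)
      then have "err (z k) u - err (z k) v \<le> 1/20 * \<sigma> k" using n by (rule mult_right_le_imp_le)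
      then show "err (?s (Suc k)) u - err (?s (Suc k)) v \<le> \<sigma> (Suc k) / 10" using half[of k] by simp
    qed
  qed
  have osc: "err (z k) t - err (z k) w \<le> 30 * \<Delta> * (\<sigma> k / real n)" if "t \<in> V" "w \<in> V" for t w
  proof -
    have "(err (z k) t - err (z k) w) * real n \<le> 26.1 * \<Delta> * \<sigma> k"
      using zosc[of k t w] start[of k] that by blast
    also have "\<dots> \<le> 30 * \<Delta> * \<sigma> k" using \<sigma>[of k] by (intro mult_right_mono) auto
    finally show ?thesis using n by (simp add: pos_le_divide_eq)
  qed
  show "gauge_error n loc E0 d (z k) \<le> 30 * \<Delta> * (\<sigma> k / real n)"
    by (rule gauge_error_le(1)) (rule osc)
  show "0 \<le> gauge_error n loc E0 d (z k)"
    by (rule gauge_error_le(2)) (rule osc)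
qed

end

text \<open>The empty set is cut out by the constant polynomial 1, and the configuration space has a
  point even for \<open>n = 0\<close>.\<close>

lemma empty_real_algebraic: "real_algebraic_subset n {}" "{} \<noteq> configs n"
proof -
  have "finite {\<lambda>_. 1 :: real}" "\<forall>p\<in>{\<lambda>_. 1}. config_polynomial n p"
    by (auto intro: config_polynomial.const)
  then show "real_algebraic_subset n {}"
    unfolding real_algebraic_subset_def by (intro exI[of _ "{\<lambda>_. 1}"]) simp
  show "{} \<noteq> configs n" using PiE_eq_empty_iff[of "{..<n}" "\<lambda>_. UNIV :: (real^3) set"] by (auto simp: configs_def)
qed

theorem theoremF1:
  "\<exists>(c::real) (\<kappa>::real) (n0::nat) (C::real) (Z :: nat \<Rightarrow> (nat \<Rightarrow> real^3) set).
     c > 0 \<and> \<kappa> > 0 \<and> c = 1 / 10^5 \<and> \<kappa> = 1 / 28 \<and>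
     (\<forall>n. real_algebraic_subset n (Z n) \<and> Z n \<noteq> configs n) \<and>
     (\<forall>n x E0 Eb d score R zLS \<sigma> z.
        n \<ge> n0 \<and>
        camera_setting n x E0 Eb d \<and>
        x \<notin> Z n \<and>
        (\<forall>t\<in>clean_triples n E0. nondegenerate d t) \<and>
        real (max_degree n Eb) \<le> c * real n \<and>
        row_system n d R \<and>
        (\<forall>t\<in>retained n d. 0 \<le> score t \<and> score t \<le> 1) \<and>
        (\<forall>t\<in>clean_retained n E0 d. score t = 1) \<and>
        is_arg_min (ls_objective d R score) (\<lambda>y. y \<in> log_scales n d) zLS \<and>
        \<sigma> 0 > 0 \<and>
        \<sigma> 0 \<ge> 80 * max_ls_residual d R score zLS \<and>
        (\<forall>k. \<sigma> (Suc k) = 1/2 * \<sigma> k) \<and>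
        (\<forall>k. z k \<in> log_scales n d \<and>
             cluster_point
               (\<lambda>m. (prox_irls_map n d R score (\<kappa> * real n) (\<sigma> k) ^^ m)
                      (case k of 0 \<Rightarrow> zLS | Suc j \<Rightarrow> z j))
               (z k))
        \<longrightarrow>
        ((\<lambda>k. gauge_error n x E0 d (z k)) \<longlonglongrightarrow> 0) \<and>
        (\<forall>k. gauge_error n x E0 d (z k) \<le> C * real (max_degree n Eb) * (\<sigma> k / real n) \<and>
             C * real (max_degree n Eb) * (\<sigma> k / real n) \<le> C * c * \<sigma> k))"
proof -
  have bound: "gauge_error n x E0 d (z k) \<le> 30 * real (max_degree n Eb) * (\<sigma> k / real n)"
    "0 \<le> gauge_error n x E0 d (z k)"
    "30 * real (max_degree n Eb) * (\<sigma> k / real n) \<le> 30 * (1 / 10^5) * \<sigma> k"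
    "(\<lambda>k. 30 * real (max_degree n Eb) * (\<sigma> k / real n)) \<longlonglongrightarrow> 0"
    if n: "1000000 \<le> n" and setting: "camera_setting n x E0 Eb d"
      and nondeg: "\<forall>t\<in>clean_triples n E0. nondegenerate d t"
      and deg: "real (max_degree n Eb) \<le> 1 / 10^5 * real n"
      and rows: "row_system n d R"
      and score: "\<forall>t\<in>retained n d. 0 \<le> score t \<and> score t \<le> 1" "\<forall>t\<in>clean_retained n E0 d. score t = 1"
      and LS: "is_arg_min (ls_objective d R score) (\<lambda>y. y \<in> log_scales n d) zLS"
      and \<sigma>0: "\<sigma> 0 > 0" "\<sigma> 0 \<ge> 80 * max_ls_residual d R score zLS"
      and half: "\<forall>k. \<sigma> (Suc k) = 1/2 * \<sigma> k"
      and z: "\<forall>k. z k \<in> log_scales n d \<and>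
             cluster_point
               (\<lambda>m. (prox_irls_map n d R score (1 / 28 * real n) (\<sigma> k) ^^ m)
                      (case k of 0 \<Rightarrow> zLS | Suc j \<Rightarrow> z j))
               (z k)"
    for n x E0 Eb d score R zLS \<sigma> z k
  proof -
    interpret large_camera_rows n x E0 Eb d score R
      by unfold_locales (use n setting nondeg deg rows score in auto)
    have zLS: "zLS \<in> log_scales n d" using LS by (simp add: is_arg_min_def)
    show "gauge_error n x E0 d (z k) \<le> 30 * real (max_degree n Eb) * (\<sigma> k / real n)"
      "0 \<le> gauge_error n x E0 d (z k)"
      by (rule graduated_irls_error[where \<sigma> = \<sigma> and z = z and k = k, OF zLS \<sigma>0 spec[OF half]
            conjunct1[OF spec[OF z]] conjunct2[OF spec[OF z]]])+
    have \<sigma>_eq: "\<sigma> k = \<sigma> 0 * (1/2)^k" for k using half by (induction k) auto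
    have "0 < \<sigma> k" using \<sigma>0(1) by (subst \<sigma>_eq) simp
    then have "real (max_degree n Eb) * \<sigma> k \<le> 1 / 10^5 * real n * \<sigma> k"
      using deg by (intro mult_right_mono) auto
    then show "30 * real (max_degree n Eb) * (\<sigma> k / real n) \<le> 30 * (1 / 10^5) * \<sigma> k"
      using n by (simp add: pos_divide_le_eq mult_ac)
    have "(\<lambda>k. 30 * real (max_degree n Eb) * (\<sigma> 0 * (1/2)^k / real n)) \<longlonglongrightarrow> 30 * real (max_degree n Eb) * (\<sigma> 0 * 0 / real n)"
      by (intro tendsto_intros LIMSEQ_realpow_zero) (use n in auto)
    then have "(\<lambda>k. 30 * real (max_degree n Eb) * (\<sigma> 0 * (1/2)^k / real n)) \<longlonglongrightarrow> 0" by simp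
    then show "(\<lambda>k. 30 * real (max_degree n Eb) * (\<sigma> k / real n)) \<longlonglongrightarrow> 0"
      by (simp only: \<sigma>_eq[symmetric])
  qed
  show ?thesis
  \<comment> \<open>The constant 30 rounds up 26.1 = 8.7 * 3, and 1000000 is the size from which the
    additive constants in the counts are negligible.\<close>
  proof (rule exI[of _ "1 / 10^5"], rule exI[of _ "1 / 28"], rule exI[of _ 1000000], rule exI[of _ 30],
      rule exI[of _ "\<lambda>_. {}"], intro conjI allI impI; (elim conjE)?)
    fix n x E0 Eb d score R zLS \<sigma> z
    assume h: "1000000 \<le> n" "camera_setting n x E0 Eb d" "\<forall>t\<in>clean_triples n E0. nondegenerate d t"
      "real (max_degree n Eb) \<le> 1 / 10^5 * real n" "row_system n d R"
      "\<forall>t\<in>retained n d. 0 \<le> score t \<and> score t \<le> 1" "\<forall>t\<in>clean_retained n E0 d. score t = 1"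
      "is_arg_min (ls_objective d R score) (\<lambda>y. y \<in> log_scales n d) zLS"
      "\<sigma> 0 > 0" "\<sigma> 0 \<ge> 80 * max_ls_residual d R score zLS" "\<forall>k. \<sigma> (Suc k) = 1/2 * \<sigma> k"
      "\<forall>k. z k \<in> log_scales n d \<and>
             cluster_point
               (\<lambda>m. (prox_irls_map n d R score (1 / 28 * real n) (\<sigma> k) ^^ m)
                      (case k of 0 \<Rightarrow> zLS | Suc j \<Rightarrow> z j))
               (z k)"
    note b = bound[OF h]
    show "(\<lambda>k. gauge_error n x E0 d (z k)) \<longlonglongrightarrow> 0"
      by (rule tendsto_sandwich[OF _ _ tendsto_const b(4)]) (use b(1,2) in auto)
    fix k
    show "gauge_error n x E0 d (z k) \<le> 30 * real (max_degree n Eb) * (\<sigma> k / real n)"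
      by (rule b(1))
    show "30 * real (max_degree n Eb) * (\<sigma> k / real n) \<le> 30 * (1 / 10^5) * \<sigma> k"
      by (rule b(3))
  qed (use empty_real_algebraic in auto)
qed

end
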